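(* Let $q,\omega,c$ and the sets $X_{i,c}$ be as in the context. Let $A$ and $B$ be subsets of $\{0,1,\ldots,2q+1\}$ such that $A\cap B=X_{3,c}$ and, as multisets, $A\cup B=X_{1,c}\cup X_{3,c}\cup X_{3,c}$. Let $\tau=0$ if $q\equiv3\pmod 4$ and $\tau=1$ if $q\equiv1\pmod4$, and define $$D_0=\{(0,y)\mid y\in C_\tau^{(2,q^2)}\},\qquad D_1=\{(y,0)\mid y\in C_0^{(2,q^2)}\},$$ $$D_2=\{(xy,xy^{-1}\omega^i)\mid x\in\mathbb{F}_q^*,\,y\in C_0^{(2,q^2)},\,i\in A\},\qquad D_3=\{(xy,xy^{-1}\omega^i)\mid x\in\mathbb{F}_q^*,\,y\in C_1^{(2,q^2)},\,i\in B\}.$$ For $S\subseteq\{0,1,\ldots,2q+1\}$ let $S_e$ and $S_o$ denote the sets of even and odd elements of $S$, respectively. (1) If $|A|=|B|=\frac{q+1}{2}$ and $|A_e|+|B_o|=|A_o|+|B_e|-2(-1)^{\frac{q-1}{2}}$, then $E_0=D_0\cup D_2\cup D_3$ is a type Q set in $\mathbb{F}_{q^2}\times\mathbb{F}_{q^2}$. (2) If $|A|=\frac{q+3}{2}$, $|B|=\frac{q-1}{2}$ and $|A_e|+|B_o|=|A_o|+|B_e|$, then $E_1=D_1\cup D_2\cup D_3$ is a type Q set in $\mathbb{F}_{q^2}\times\mathbb{F}_{q^2}$.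
   Context: Let $q$ be an odd prime power, a power of the prime $p$, let $\omega$ be a primitive element of $\mathbb{F}_{q^2}$, and let $c$ be an odd integer in $\{0,1,\ldots,2q+1\}=\mathbb{Z}_{2q+2}$. $\mathrm{Tr}_{q^2/q}(x)=x+x^q$. $C_0^{(2,q)}$ and $C_1^{(2,q)}$ are the sets of nonzero squares and of nonsquares of $\mathbb{F}_q$; $C_i^{(N,q^2)}=\omega^i\langle\omega^N\rangle$ for $N\mid q^2-1$ (index modulo $N$). In $\mathbb{Z}_{2q+2}$ put $I_1=\{i\mid \mathrm{Tr}_{q^2/q}(\omega^i)=0\}$, $I_2=\{i\mid \mathrm{Tr}_{q^2/q}(\omega^i)\in C_0^{(2,q)}\}$, $I_3=\{i\mid \mathrm{Tr}_{q^2/q}(\omega^i)\in C_1^{(2,q)}\}$ (well defined modulo $2(q+1)$), and $J_i=I_i-c\pmod{2(q+1)}$. Put $X_{1,c}=(I_1\cap J_2)\cup(I_2\cap J_1)$, $X_{2,c}=(I_1\cap J_3)\cup(I_3\cap J_1)$, $X_{3,c}=I_2\cap J_2$, $X_{4,c}=I_3\cap J_3$, $X_{5,c}=(I_2\cap J_3)\cup(I_3\cap J_2)$. Let $\psi_{\mathbb{F}_{q^2}}(x)=\zeta_p^{\mathrm{Tr}_{q^2/p}(x)}$ be the canonical additive character ($\zeta_p$ a fixed primitive complex $p$-th root of unity). For $E\subseteq\mathbb{F}_{q^2}\times\mathbb{F}_{q^2}$ put $\psi_{a,b}(E)=\sum_{(x,y)\in E}\psi_{\mathbb{F}_{q^2}}(ax+by)$.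 A set $E\subseteq(\mathbb{F}_{q^2}\times\mathbb{F}_{q^2})\setminus\{(0,0)\}$ closed under multiplication by $\mathbb{F}_q^*$ is of type Q if $|E|=\frac{q^4-1}{4}$ and the values $\psi_{a,b}(E)$, over all $(a,b)\neq(0,0)$, are exactly the two values $\frac{q^2-1}{4}$ and $\frac{-3q^2-1}{4}$. (Equivalently, the corresponding point set of $\mathrm{PG}(3,q)$ has $\frac{q^4-1}{4(q-1)}$ points and every plane meets it in $\frac{(q-1)^2}{4}$ or $\frac{(q+1)^2}{4}$ points.) *)

theory Defs
  imports
    Complex_Main
    "HOL-Library.Cardinality"
    "HOL-Library.Multiset"
    "HOL-Computational_Algebra.Primes"
begin

text \<open>
  The field with \<open>q\<^sup>2\<close> elements is a type \<open>'a\<close> of class \<open>finite_field\<close> with \<open>CARD('a) = q\<^sup>2\<close>;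
  its subfield with \<open>q\<close> elements is the set of fixed points of the map \<open>x \<mapsto> x ^ q\<close>.
  The residues modulo \<open>2 * q + 2\<close> are represented by the natural numbers \<open>0, \<dots>, 2 * q + 1\<close>.
\<close>

definition subfield_q :: "nat \<Rightarrow> 'a::finite_field set"
  where "subfield_q q = {x. x ^ q = x}"

definition primitive_elem :: "'a::finite_field \<Rightarrow> bool"
  where "primitive_elem \<omega> \<longleftrightarrow> {\<omega> ^ k | k::nat. True} = UNIV - {0}"

definition rel_trace :: "nat \<Rightarrow> 'a::finite_field \<Rightarrow> 'a"
  where "rel_trace q x = x + x ^ q"

definition nonzero_squares :: "nat \<Rightarrow> 'a::finite_field set"
  where "nonzero_squares q = {x\<^sup>2 | x. x \<in> subfield_q q - {0}}"

text \<open>The coset \<open>\<omega>\<^sup>i\<langle>\<omega>\<^sup>N\<rangle>\<close>; as \<open>\<omega>\<close> has finite order, nonnegative exponents suffice.\<close>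

definition cyclotomic_class :: "'a::finite_field \<Rightarrow> nat \<Rightarrow> nat \<Rightarrow> 'a set"
  where "cyclotomic_class \<omega> N i = {\<omega> ^ i * (\<omega> ^ N) ^ k | k::nat. True}"

definition I1 :: "nat \<Rightarrow> 'a::finite_field \<Rightarrow> nat set"
  where "I1 q \<omega> = {i \<in> {0..2*q+1}. rel_trace q (\<omega> ^ i) = 0}"

definition I2 :: "nat \<Rightarrow> 'a::finite_field \<Rightarrow> nat set"
  where "I2 q \<omega> = {i \<in> {0..2*q+1}. rel_trace q (\<omega> ^ i) \<in> nonzero_squares q}"

definition shift_down :: "nat \<Rightarrow> nat \<Rightarrow> nat set \<Rightarrow> nat set"
  where "shift_down q c I = (\<lambda>i. nat ((int i - int c) mod (2 * (int q + 1)))) ` I"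

definition X1 :: "nat \<Rightarrow> 'a::finite_field \<Rightarrow> nat \<Rightarrow> nat set"
  where "X1 q \<omega> c =
    (I1 q \<omega> \<inter> shift_down q c (I2 q \<omega>)) \<union> (I2 q \<omega> \<inter> shift_down q c (I1 q \<omega>))"

definition X3 :: "nat \<Rightarrow> 'a::finite_field \<Rightarrow> nat \<Rightarrow> nat set"
  where "X3 q \<omega> c = I2 q \<omega> \<inter> shift_down q c (I2 q \<omega>)"

definition primitive_root_of_unity :: "nat \<Rightarrow> complex \<Rightarrow> bool"
  where "primitive_root_of_unity p \<zeta> \<longleftrightarrow> \<zeta> ^ p = 1 \<and> (\<forall>k. 0 < k \<and> k < p \<longrightarrow> \<zeta> ^ k \<noteq> 1)"

text \<open>Trace from the field with \<open>p ^ n\<close> elements to its prime subfield.\<close>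

definition abs_trace :: "nat \<Rightarrow> nat \<Rightarrow> 'a::finite_field \<Rightarrow> 'a"
  where "abs_trace p n x = (\<Sum>k<n. x ^ (p ^ k))"

text \<open>
  The trace lies in the prime subfield, that is, it is \<open>of_nat k\<close> for a unique \<open>k < p\<close>;
  this \<open>k\<close> is the exponent of \<open>\<zeta>\<close>.
\<close>

definition canonical_char :: "nat \<Rightarrow> nat \<Rightarrow> complex \<Rightarrow> 'a::finite_field \<Rightarrow> complex"
  where "canonical_char p n \<zeta> x = \<zeta> ^ (THE k. k < p \<and> of_nat k = abs_trace p n x)"

definition char_sum ::
    "nat \<Rightarrow> nat \<Rightarrow> complex \<Rightarrow> 'a::finite_field \<Rightarrow> 'a \<Rightarrow> ('a \<times> 'a) set \<Rightarrow> complex"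
  where "char_sum p n \<zeta> a b E = (\<Sum>(x, y)\<in>E. canonical_char p n \<zeta> (a * x + b * y))"

text \<open>Here \<open>q = p ^ m\<close>, so the ambient field has \<open>p ^ (2 * m)\<close> elements.\<close>

definition type_Q :: "nat \<Rightarrow> nat \<Rightarrow> complex \<Rightarrow> ('a::finite_field \<times> 'a) set \<Rightarrow> bool"
  where "type_Q p m \<zeta> E \<longleftrightarrow>
    (let q = p ^ m in
      E \<subseteq> UNIV - {(0, 0)} \<and>
      (\<forall>t \<in> subfield_q q - {0}. \<forall>(x, y) \<in> E. (t * x, t * y) \<in> E) \<and>
      real (card E) = (real q ^ 4 - 1) / 4 \<and>
      {char_sum p (2 * m) \<zeta> a b E | a b. (a, b) \<noteq> (0, 0)} =
        {(of_nat q ^ 2 - 1) / 4, (- 3 * of_nat q ^ 2 - 1) / 4})"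

definition D0 :: "nat \<Rightarrow> 'a::finite_field \<Rightarrow> ('a \<times> 'a) set"
  where "D0 q \<omega> =
    (let \<tau> = (if q mod 4 = 3 then 0 else 1) in {(0, y) | y. y \<in> cyclotomic_class \<omega> 2 \<tau>})"

definition D1 :: "'a::finite_field \<Rightarrow> ('a \<times> 'a) set"
  where "D1 \<omega> = {(y, 0) | y. y \<in> cyclotomic_class \<omega> 2 0}"

definition D2 :: "nat \<Rightarrow> 'a::finite_field \<Rightarrow> nat set \<Rightarrow> ('a \<times> 'a) set"
  where "D2 q \<omega> A = {(x * y, x * inverse y * \<omega> ^ i) | x y i.
    x \<in> subfield_q q - {0} \<and> y \<in> cyclotomic_class \<omega> 2 0 \<and> i \<in> A}"

definition D3 :: "nat \<Rightarrow> 'a::finite_field \<Rightarrow> nat set \<Rightarrow> ('a \<times> 'a) set"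
  where "D3 q \<omega> B = {(x * y, x * inverse y * \<omega> ^ i) | x y i.
    x \<in> subfield_q q - {0} \<and> y \<in> cyclotomic_class \<omega> 2 1 \<and> i \<in> B}"

definition evens :: "nat set \<Rightarrow> nat set"
  where "evens S = {i \<in> S. even i}"

definition odds :: "nat set \<Rightarrow> nat set"
  where "odds S = {i \<in> S. odd i}"

end

theory Submission
  imports Defs "HOL-Number_Theory.Cong" "HOL-Computational_Algebra.Polynomial"
begin

text \<open>
  Write \<open>\<chi>\<close> and \<open>\<eta>\<close> for the quadratic characters of the large and of the small field, \<open>tr\<close> for the
  relative trace and \<open>\<theta> = \<omega>\<^sup>c\<close>, a nonsquare. Since \<open>x\<^sup>2\<omega>\<^sup>i\<close> is the product of the coordinates
  of \<open>(xy, xy\<^sup>-\<^sup>1\<omega>\<^sup>i)\<close>, the set \<open>D\<^sub>2 \<union> D\<^sub>3\<close> consists of the pairs \<open>(U, V)\<close> such that \<open>UV\<close> lies in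
  the union of classes given by \<open>A\<close> if \<open>\<chi>(U) = 1\<close> and by \<open>B\<close> if \<open>\<chi>(U) = -1\<close>. Its indicator is half
  of \<open>(1\<^sub>A + 1\<^sub>B)(UV) + \<chi>(U) (1\<^sub>A - 1\<^sub>B)(UV)\<close>.

  The hypothesis on the multiset union says exactly that
  \<open>2 (1\<^sub>A + 1\<^sub>B)(z) = (1 + \<eta>(tr z)) (1 + \<eta>(tr (\<theta>z)))\<close>. Expanding \<open>\<eta>\<close> by Gauss sums, the Fourier
  transforms of \<open>\<eta>(tr (UV))\<close>, \<open>\<eta>(tr (\<theta>UV))\<close> and of their product are, up to the factor \<open>q\<^sup>2\<close> and
  signs, \<open>\<eta>(tr (ab))\<close>, \<open>\<eta>(tr (ab/\<theta>))\<close> and their product.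

  The difference \<open>1\<^sub>A - 1\<^sub>B\<close> is supported on the two classes forming \<open>X\<^sub>1\<close>, on which \<open>tr z = 0\<close> or
  \<open>tr (\<theta>z) = 0\<close>; the cardinality and parity hypotheses determine its two signs. The pairs with
  \<open>tr (UV) = 0\<close> form a hyperbolic quadric, ruled by the lines \<open>{(lrW, W\<^sup>q)}\<close> with \<open>r\<close> in the small
  field and \<open>l\<close> a fixed nonzero element of trace zero, which reduces the transform to the sum of \<open>\<chi>\<close>
  over a line. The transform of \<open>D\<^sub>0\<close> or \<open>D\<^sub>1\<close> cancels exactly the terms
  that are linear in \<open>q\<close>. Both values occur because the transform has mean zero.
\<close>

section \<open>Quadratic characters and the trace\<close>

definition quad_char :: "'a::field \<Rightarrow> complex"
  where "quad_char x = (if x = 0 then 0 else if \<exists>y. x = y\<^sup>2 then 1 else - 1)"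

text \<open>Outside the small field the value is the default -1, so the product and quotient rules
  for \<eta> below assume membership in \<open>F\<close>.\<close>

definition sub_char :: "nat \<Rightarrow> 'a::finite_field \<Rightarrow> complex"
  where "sub_char q x = (if x = 0 then 0 else if x \<in> nonzero_squares q then 1 else - 1)"

text \<open>\<open>frobenius_add\<close> carries the prime power shape of \<open>q\<close>: it makes
  \<open>x ^ q\<close> a field automorphism with the small field as fixed field.\<close>

locale quadratic_extension =
  fixes q :: nat and \<omega> :: "'a::finite_field"
  assumes odd_q: "odd q" and q_gt_1: "q > 1"
    and card_field: "CARD('a) = q\<^sup>2"
    and primitive: "primitive_elem \<omega>"
    and frobenius_add: "\<And>x y :: 'a. (x + y) ^ q = x ^ q + y ^ q"
begin

abbreviation "F \<equiv> subfield_q q :: 'a set"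
abbreviation "tr \<equiv> rel_trace q :: 'a \<Rightarrow> 'a"
abbreviation "\<chi> \<equiv> quad_char :: 'a \<Rightarrow> complex"
abbreviation "\<eta> \<equiv> sub_char q :: 'a \<Rightarrow> complex"

section \<open>Exponents of the primitive element\<close>

lemma q_square: "q\<^sup>2 - 1 = (q - 1) * (q + 1)"
  by (simp add: power2_eq_square algebra_simps)

lemma q_square_pos: "q\<^sup>2 - 1 > 0"
  using q_gt_1 unfolding q_square by simp

lemma even_q_square: "even (q\<^sup>2 - 1)"
  using odd_q unfolding q_square by simp

lemma generator_nonzero: "\<omega> \<noteq> 0"
proof
  assume "\<omega> = 0"
  moreover have "\<omega> ^ 1 \<in> {\<omega> ^ k | k::nat. True}"
    by blast
  ultimately show False
    using primitive unfolding primitive_elem_def by (metis DiffE \<open>\<omega> = 0\<close> power_one_right singletonI)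
qed

lemma power_q_q: "(x ^ q) ^ q = (x :: 'a)"
  by (metis card_field finite_field_power_card_eq_same power2_eq_square power_mult)

lemma power_group_order: "x ^ (q\<^sup>2 - 1) = 1" if "x \<noteq> (0 :: 'a)"
proof -
  have "x * x ^ (q\<^sup>2 - 1) = x ^ q\<^sup>2"
    using q_gt_1 by (simp flip: power_Suc)
  also have "\<dots> = x"
    by (metis card_field finite_field_power_card_eq_same)
  finally show ?thesis
    using that by simp
qed

lemma generator_power_mod: "\<omega> ^ (k mod (q\<^sup>2 - 1)) = \<omega> ^ k"
proof -
  have "\<omega> ^ k = \<omega> ^ (k mod (q\<^sup>2 - 1) + (q\<^sup>2 - 1) * (k div (q\<^sup>2 - 1)))"
    by simp
  also have "\<dots> = \<omega> ^ (k mod (q\<^sup>2 - 1))"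
    unfolding power_add power_mult power_group_order[OF generator_nonzero] by simp
  finally show ?thesis ..
qed

lemma obtain_log:
  assumes "x \<noteq> 0"
  obtains k where "x = \<omega> ^ k" "k < q\<^sup>2 - 1"
proof -
  have "x \<in> {\<omega> ^ k | k::nat. True}"
    using primitive assms by (auto simp: primitive_elem_def)
  then obtain k where "x = \<omega> ^ k"
    by blast
  then show thesis
    using that[of "k mod (q\<^sup>2 - 1)"] q_square_pos generator_power_mod by auto
qed

text \<open>Exponents below \<open>q\<^sup>2 - 1\<close> already reach all
  \<open>q\<^sup>2 - 1\<close> nonzero elements, so by counting the power map is injective on
  them.\<close>

lemma generator_power_eq_iff: "\<omega> ^ i = \<omega> ^ j \<longleftrightarrow> i mod (q\<^sup>2 - 1) = j mod (q\<^sup>2 - 1)"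
proof
  assume eq: "\<omega> ^ i = \<omega> ^ j"
  have "(\<lambda>k. \<omega> ^ k) ` {..<q\<^sup>2 - 1} = UNIV - {0}"
  proof (intro equalityI subsetI)
    fix x :: 'a assume "x \<in> UNIV - {0}"
    then obtain k where "x = \<omega> ^ k" "k < q\<^sup>2 - 1"
      by (metis DiffD2 obtain_log singletonI)
    then show "x \<in> (\<lambda>k. \<omega> ^ k) ` {..<q\<^sup>2 - 1}"
      by blast
  qed (use generator_nonzero in auto)
  then have "card ((\<lambda>k. \<omega> ^ k) ` {..<q\<^sup>2 - 1}) = card {..<q\<^sup>2 - 1}"
    by (simp add: card_field card_Diff_singleton)
  then have "inj_on (\<lambda>k. \<omega> ^ k) {..<q\<^sup>2 - 1}"
    by (simp add: eq_card_imp_inj_on)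
  moreover have "\<omega> ^ (i mod (q\<^sup>2 - 1)) = \<omega> ^ (j mod (q\<^sup>2 - 1))"
    by (simp only: generator_power_mod eq)
  ultimately show "i mod (q\<^sup>2 - 1) = j mod (q\<^sup>2 - 1)"
    using q_square_pos by (auto dest: inj_onD)
qed (metis generator_power_mod)

lemma generator_power_eq_1_iff: "\<omega> ^ i = 1 \<longleftrightarrow> (q\<^sup>2 - 1) dvd i"
  using generator_power_eq_iff[of i 0] by (simp add: dvd_eq_mod_eq_0)

text \<open>As \<open>q - 1\<close> is even, the residue of an exponent modulo
  \<open>2 * (q + 1)\<close> is determined by the field element; every use of index sets rests on
  this.\<close>

lemma dvd_group_order: "2 * (q + 1) dvd q\<^sup>2 - 1"
proof -
  have "2 dvd q - 1"
    using odd_q by simp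
  then show ?thesis
    unfolding q_square by (rule mult_dvd_mono) simp
qed

lemma generator_power_eq_imp:
  assumes "\<omega> ^ i = \<omega> ^ j" "N dvd q\<^sup>2 - 1"
  shows "i mod N = j mod N"
proof -
  have "i mod (q\<^sup>2 - 1) mod N = j mod (q\<^sup>2 - 1) mod N"
    using assms(1) by (simp only: generator_power_eq_iff)
  then show ?thesis
    using assms(2) by (simp only: mod_mod_cancel)
qed

section \<open>The subfield with \<open>q\<close> elements\<close>

lemma subfield_iff: "x \<in> F \<longleftrightarrow> x ^ q = x"
  by (simp add: subfield_q_def)

lemma F_0 [simp]: "0 \<in> F" and F_1 [simp]: "1 \<in> F"
  using q_gt_1 by (simp_all add: subfield_iff)

lemma F_add: "x \<in> F \<Longrightarrow> y \<in> F \<Longrightarrow> x + y \<in> F"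
  by (simp add: subfield_iff frobenius_add)

lemma F_mult: "x \<in> F \<Longrightarrow> y \<in> F \<Longrightarrow> x * y \<in> F"
  by (simp add: subfield_iff power_mult_distrib)

lemma F_uminus [simp]: "- x \<in> F \<longleftrightarrow> x \<in> F"
  using odd_q by (simp add: subfield_iff)

lemma F_diff: "x \<in> F \<Longrightarrow> y \<in> F \<Longrightarrow> x - y \<in> F"
  using F_add[of x "- y"] by simp

lemma F_inverse [simp]: "inverse x \<in> F \<longleftrightarrow> x \<in> F"
  by (simp add: subfield_iff power_inverse)

lemma F_divide: "x \<in> F \<Longrightarrow> y \<in> F \<Longrightarrow> x / y \<in> F"
  by (simp add: subfield_iff power_divide)

lemma F_of_nat [simp]: "of_nat n \<in> F"
  by (induction n) (auto intro: F_add)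

lemma generator_power_in_F_iff: "\<omega> ^ k \<in> F \<longleftrightarrow> (q + 1) dvd k"
proof -
  have "\<omega> ^ k \<in> F \<longleftrightarrow> \<omega> ^ (k * q) = \<omega> ^ k"
    by (simp add: subfield_iff power_mult)
  also have "\<omega> ^ (k * q) = \<omega> ^ (k * (q - 1)) * \<omega> ^ k"
    using q_gt_1 by (simp flip: power_add add: algebra_simps)
  also have "\<dots> = \<omega> ^ k \<longleftrightarrow> \<omega> ^ (k * (q - 1)) = 1"
    using generator_nonzero by simp
  also have "\<dots> \<longleftrightarrow> (q - 1) * (q + 1) dvd (q - 1) * k"
    by (simp only: generator_power_eq_1_iff q_square mult.commute)
  also have "\<dots> \<longleftrightarrow> (q + 1) dvd k"
    using q_gt_1 by (intro nat_mult_dvd_cancel1) simp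
  finally show ?thesis .
qed

lemma F_log:
  assumes "x \<in> F" "x \<noteq> 0"
  obtains k where "x = \<omega> ^ ((q + 1) * k)"
proof -
  obtain j where "x = \<omega> ^ j"
    using assms(2) by (rule obtain_log)
  with assms(1) that show thesis
    by (auto simp: generator_power_in_F_iff simp del: One_nat_def)
qed

text \<open>The nonzero elements of \<open>F\<close> are the powers of
  \<open>\<omega> ^ (q + 1)\<close>, which has order \<open>q - 1\<close>.\<close>

lemma card_F: "card F = q"
proof -
  have eq: "F - {0} = (\<lambda>k. \<omega> ^ ((q + 1) * k)) ` {..<q - 1}" (is "_ = ?f ` _")
  proof (intro equalityI subsetI)
    fix x assume x: "x \<in> F - {0}"
    then obtain j where j: "x = \<omega> ^ j" "j < q\<^sup>2 - 1"
      by (auto elim: obtain_log)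
    with x obtain k where k: "j = (q + 1) * k"
      by (auto simp: generator_power_in_F_iff simp del: One_nat_def elim: dvdE)
    with j have "(q + 1) * k < (q + 1) * (q - 1)"
      by (simp only: q_square mult.commute)
    then have "k < q - 1"
      by (simp only: mult_less_cancel1)
    with j k show "x \<in> ?f ` {..<q - 1}"
      by auto
  next
    fix x assume "x \<in> ?f ` {..<q - 1}"
    then obtain k where "x = ?f k" by blast
    then show "x \<in> F - {0}"
      using generator_nonzero generator_power_in_F_iff[of "(q + 1) * k"]
      by (simp del: mult_Suc mult_Suc_right add: dvd_def)
  qed
  have "inj_on ?f {..<q - 1}"
  proof (rule inj_onI)
    fix i j assume ij: "i \<in> {..<q - 1}" "j \<in> {..<q - 1}" "?f i = ?f j"
    then have "(q + 1) * i < q\<^sup>2 - 1" "(q + 1) * j < q\<^sup>2 - 1"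
      unfolding q_square by (simp_all only: mult.commute[of "q - 1"] mult_less_cancel1) simp_all
    with ij(3) have "(q + 1) * i = (q + 1) * j"
      by (simp only: generator_power_eq_iff mod_less)
    then show "i = j"
      by (simp only: mult_cancel1) simp
  qed
  then have "card (F - {0}) = q - 1"
    unfolding eq by (simp add: card_image)
  then show ?thesis
    using q_gt_1 by (simp add: card_Diff_singleton)
qed

lemma card_F_nonzero: "card (F - {0}) = q - 1"
  by (simp add: card_F card_Diff_singleton)

text \<open>Translation by 1 permutes \<open>F\<close>, so comparing the sums of all elements gives
  \<open>of_nat q = 0\<close>; in characteristic two an odd \<open>q\<close> would give 1
  instead.\<close>

lemma char_not_2: "(2 :: 'a) \<noteq> 0"
proof
  assume "(2 :: 'a) = 0"
  have "(\<Sum>x\<in>F. x) = (\<Sum>x\<in>F. x + 1)"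
    by (rule sum.reindex_bij_witness[of _ "\<lambda>x. x + 1" "\<lambda>x. x - 1"])
       (auto intro: F_add F_diff)
  then have "(of_nat q :: 'a) = 0"
    by (simp add: sum.distrib card_F)
  moreover have "(of_nat q :: 'a) = 1"
    using odd_q \<open>2 = 0\<close> by (auto elim!: oddE)
  ultimately show False
    by simp
qed

section \<open>The relative trace\<close>

lemma tr_in_F [simp]: "tr x \<in> F"
  by (simp add: rel_trace_def subfield_iff frobenius_add power_q_q add.commute)

lemma tr_0 [simp]: "tr 0 = 0"
  using q_gt_1 by (simp add: rel_trace_def)

lemma tr_add: "tr (x + y) = tr x + tr y"
  by (simp add: rel_trace_def frobenius_add)

lemma tr_uminus [simp]: "tr (- x) = - tr x"
  using odd_q by (simp add: rel_trace_def)

lemma tr_diff: "tr (x - y) = tr x - tr y"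
  using tr_add[of x "- y"] by simp

lemma tr_scale: "s \<in> F \<Longrightarrow> tr (s * x) = s * tr x"
  by (simp add: rel_trace_def subfield_iff power_mult_distrib algebra_simps)

lemma tr_power_q: "tr (x ^ q) = tr x"
  by (simp add: rel_trace_def power_q_q add.commute)

text \<open>Supplies an element of trace one, so that \<open>s * inverse 2\<close> has trace
  \<open>s\<close> for \<open>s\<close> in \<open>F\<close>; the Gauss sum of the small field is
  built on it.\<close>

lemma tr_half: "tr (inverse 2) = 1"
proof -
  have "inverse 2 \<in> F"
    using F_inverse[of 2] F_of_nat[of 2] by (simp del: F_of_nat F_inverse)
  then have "tr (inverse 2) = inverse 2 + inverse 2"
    by (simp only: rel_trace_def subfield_iff)
  also have "\<dots> = 2 * inverse 2"
    by (simp only: mult_2)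
  also have "\<dots> = 1"
    using char_not_2 by (rule right_inverse)
  finally show ?thesis .
qed

lemma tr_eq_0_iff: "tr x = 0 \<longleftrightarrow> x ^ q = - x"
  by (simp add: rel_trace_def eq_neg_iff_add_eq_0 add.commute)

text \<open>The map \<open>x ^ q\<close> negates both elements and the signs cancel, so trace-zero
  elements are proportional over \<open>F\<close>. For \<open>y = 0\<close> the quotient is 0 by
  convention.\<close>

lemma tr_zero_ratio:
  assumes "tr x = 0" "tr y = 0"
  shows "x / y \<in> F"
  using assms by (simp add: tr_eq_0_iff subfield_iff power_divide)

lemma norm_in_F [simp]: "x ^ (q + 1) \<in> F"
  by (simp add: subfield_iff power_mult_distrib power_q_q mult.commute)

section \<open>The quadratic characters as parities of exponents\<close>

lemma square_iff: "(\<exists>y. \<omega> ^ k = y\<^sup>2) \<longleftrightarrow> even k"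
proof
  assume "\<exists>y. \<omega> ^ k = y\<^sup>2"
  then obtain y where y: "\<omega> ^ k = y\<^sup>2" by blast
  then have "y \<noteq> 0"
    using generator_nonzero by auto
  then obtain j where "y = \<omega> ^ j"
    by (rule obtain_log)
  with y have "\<omega> ^ k = \<omega> ^ (2 * j)"
    by (simp flip: power_mult add: mult.commute)
  then have "k mod 2 = (2 * j) mod 2"
    using even_q_square by (rule generator_power_eq_imp)
  then show "even k"
    by presburger
next
  assume "even k"
  then show "\<exists>y. \<omega> ^ k = y\<^sup>2"
    by (auto elim!: evenE intro!: exI[of _ "\<omega> ^ (k div 2)"] simp flip: power_mult simp: mult.commute)
qed

lemma quad_char_power: "\<chi> (\<omega> ^ k) = (- 1) ^ k"
  using generator_nonzero square_iff[of k] by (simp add: quad_char_def)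

lemma nonzero_squares_subset: "nonzero_squares q \<subseteq> F - {0}"
  by (auto simp: nonzero_squares_def power2_eq_square intro: F_mult)

lemma sub_square_iff: "\<omega> ^ ((q + 1) * k) \<in> nonzero_squares q \<longleftrightarrow> even k"
proof
  assume "\<omega> ^ ((q + 1) * k) \<in> nonzero_squares q"
  then obtain y where y: "\<omega> ^ ((q + 1) * k) = y\<^sup>2" "y \<in> F" "y \<noteq> 0"
    by (auto simp: nonzero_squares_def)
  obtain j where j: "y = \<omega> ^ ((q + 1) * j)"
    using y(2,3) by (rule F_log)
  have "\<omega> ^ ((q + 1) * k) = \<omega> ^ ((q + 1) * (2 * j))"
    unfolding y(1) j by (simp only: power_mult[symmetric] ac_simps)
  then have "((q + 1) * k) mod (2 * (q + 1)) = ((q + 1) * (2 * j)) mod (2 * (q + 1))"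
    using dvd_group_order by (rule generator_power_eq_imp)
  then have "(q + 1) * (k mod 2) = (q + 1) * ((2 * j) mod 2)"
    by (simp only: mult.commute[of 2] mult_mod_right)
  then have "k mod 2 = 0"
    by simp
  then show "even k"
    by presburger
next
  assume "even k"
  then obtain j where "k = 2 * j" ..
  then have "\<omega> ^ ((q + 1) * k) = (\<omega> ^ ((q + 1) * j))\<^sup>2"
    by (simp only: power_mult[symmetric] ac_simps)
  moreover have "\<omega> ^ ((q + 1) * j) \<in> F - {0}"
    using generator_nonzero generator_power_in_F_iff[of "(q + 1) * j"]
    by (simp del: mult_Suc mult_Suc_right add: dvd_def)
  ultimately show "\<omega> ^ ((q + 1) * k) \<in> nonzero_squares q"
    unfolding nonzero_squares_def by blast
qed

lemma sub_char_power: "\<eta> (\<omega> ^ ((q + 1) * k)) = (- 1) ^ k"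
  using generator_nonzero sub_square_iff[of k] by (simp add: sub_char_def del: One_nat_def)

lemma quad_char_0 [simp]: "\<chi> 0 = 0" and sub_char_0 [simp]: "\<eta> 0 = 0"
  by (simp_all add: quad_char_def sub_char_def)

lemma quad_char_mult: "\<chi> (x * y) = \<chi> x * \<chi> y"
proof (cases "x = 0 \<or> y = 0")
  case False
  then obtain i j where "x = \<omega> ^ i" "y = \<omega> ^ j"
    by (metis obtain_log)
  then show ?thesis
    by (simp add: quad_char_power flip: power_add)
qed auto

lemma sub_char_mult:
  assumes "x \<in> F" "y \<in> F"
  shows "\<eta> (x * y) = \<eta> x * \<eta> y"
proof (cases "x = 0 \<or> y = 0")
  case False
  then obtain i j where ij: "x = \<omega> ^ ((q + 1) * i)" "y = \<omega> ^ ((q + 1) * j)"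
    using assms by (metis F_log)
  then have "x * y = \<omega> ^ ((q + 1) * (i + j))"
    by (simp only: power_add[symmetric] distrib_left)
  with ij show ?thesis
    by (simp only: sub_char_power power_add)
qed auto

text \<open>The norm sends \<open>\<omega> ^ k\<close> to the \<open>k\<close>-th power of a
  generator of the nonzero elements of \<open>F\<close>, so both sides are
  \<open>(- 1) ^ k\<close>.\<close>

lemma quad_char_norm: "\<chi> x = \<eta> (x ^ (q + 1))"
proof (cases "x = 0")
  case False
  then obtain k where "x = \<omega> ^ k"
    by (rule obtain_log)
  then show ?thesis
    by (simp only: quad_char_power power_mult[symmetric] mult.commute[of k] sub_char_power)
qed simp

text \<open>Elements of \<open>F\<close> are squares in the large field because \<open>q + 1\<close>
  is even.\<close>

lemma quad_char_F: "x \<in> F \<Longrightarrow> x \<noteq> 0 \<Longrightarrow> \<chi> x = 1"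
  by (erule (1) F_log) (use odd_q in \<open>simp add: quad_char_power power_mult del: power_Suc\<close>)

lemma quad_char_values: "x \<noteq> 0 \<Longrightarrow> \<chi> x = 1 \<or> \<chi> x = - 1"
  and sub_char_values: "x \<noteq> 0 \<Longrightarrow> \<eta> x = 1 \<or> \<eta> x = - 1"
  by (auto simp: quad_char_def sub_char_def)

lemma quad_char_eq_0_iff [simp]: "\<chi> x = 0 \<longleftrightarrow> x = 0"
  and sub_char_eq_0_iff [simp]: "\<eta> x = 0 \<longleftrightarrow> x = 0"
  by (auto simp: quad_char_def sub_char_def)

lemma quad_char_square: "x \<noteq> 0 \<Longrightarrow> \<chi> x * \<chi> x = 1"
  and sub_char_square: "x \<noteq> 0 \<Longrightarrow> \<eta> x * \<eta> x = 1"
  by (auto simp: quad_char_def sub_char_def)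

lemma quad_char_1 [simp]: "\<chi> 1 = 1"
  using quad_char_power[of 0] by simp

lemma sub_char_1 [simp]: "\<eta> 1 = 1"
  using sub_char_power[of 0] by simp

lemma quad_char_inverse: "\<chi> (inverse x) = \<chi> x"
proof (cases "x = 0")
  case False
  then have "\<chi> (inverse x) * (\<chi> x * \<chi> x) = \<chi> (inverse x * x) * \<chi> x"
    by (simp only: quad_char_mult mult.assoc)
  with False show ?thesis
    by (simp add: quad_char_square)
qed simp

lemma quad_char_divide: "\<chi> (x / y) = \<chi> x * \<chi> y"
  by (simp add: divide_inverse quad_char_mult quad_char_inverse)

lemma sub_char_inverse:
  assumes "x \<in> F"
  shows "\<eta> (inverse x) = \<eta> x"
proof (cases "x = 0")
  case False
  then have "\<eta> (inverse x) * (\<eta> x * \<eta> x) = \<eta> (inverse x * x) * \<eta> x"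
    using assms by (simp only: sub_char_mult mult.assoc F_inverse)
  with False show ?thesis
    by (simp add: sub_char_square)
qed simp

lemma sub_char_divide: "x \<in> F \<Longrightarrow> y \<in> F \<Longrightarrow> \<eta> (x / y) = \<eta> x * \<eta> y"
  by (simp add: divide_inverse sub_char_mult sub_char_inverse)

lemma quad_char_power_q: "\<chi> (x ^ q) = \<chi> x"
  by (simp add: quad_char_norm power_q_q mult.commute)

section \<open>The sign of minus one and the elements of trace zero\<close>

lemma minus_one_eq: "(- 1 :: 'a) = \<omega> ^ ((q + 1) * ((q - 1) div 2))"
proof -
  let ?z = "\<omega> ^ ((q + 1) * ((q - 1) div 2))"
  have e: "(q + 1) * ((q - 1) div 2) * 2 = q\<^sup>2 - 1"
  proof -
    have "(q - 1) div 2 * 2 = q - 1"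
      using odd_q by simp
    then show ?thesis
      by (simp only: mult.assoc q_square) (simp only: mult.commute)
  qed
  then have "?z\<^sup>2 = 1"
    by (simp only: power_mult[symmetric] power_group_order[OF generator_nonzero])
  moreover have "?z \<noteq> 1"
  proof
    assume "?z = 1"
    then have "(q\<^sup>2 - 1) dvd (q + 1) * ((q - 1) div 2)"
      by (simp only: generator_power_eq_1_iff)
    then have "q\<^sup>2 - 1 \<le> (q + 1) * ((q - 1) div 2)"
      using e q_square_pos by (intro dvd_imp_le) (auto simp: mult.commute intro: Nat.gr0I)
    with e q_square_pos show False
      by linarith
  qed
  ultimately show ?thesis
    by (simp add: power2_eq_1_iff)
qed

text \<open>The value of \<eta> at -1: it is 1 if \<open>q\<close> is 1 modulo 4 and -1 if
  \<open>q\<close> is 3 modulo 4.\<close>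

definition \<epsilon> :: complex where "\<epsilon> = (- 1) ^ ((q - 1) div 2)"

lemma sub_char_minus_1: "\<eta> (- 1) = \<epsilon>"
  by (simp only: minus_one_eq sub_char_power \<epsilon>_def)

lemma eps_square [simp]: "\<epsilon> * \<epsilon> = 1"
  by (simp add: \<epsilon>_def flip: power_mult_distrib)

lemma eps_cases: "\<epsilon> = 1 \<or> \<epsilon> = - 1"
  by (simp add: \<epsilon>_def minus_one_power_iff)

lemma sub_char_uminus: "x \<in> F \<Longrightarrow> \<eta> (- x) = \<epsilon> * \<eta> x"
  using sub_char_mult[of "- 1" x] by (simp add: sub_char_minus_1)

text \<open>Its power with exponent \<open>q - 1\<close> has half the group order as exponent and is
  therefore -1.\<close>

lemma tr_zero_generator: "tr (\<omega> ^ ((q + 1) div 2)) = 0"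
proof -
  have "\<omega> ^ ((q + 1) div 2 * (q - 1)) = - 1"
    using odd_q q_gt_1 unfolding minus_one_eq
    by (auto elim!: oddE simp: algebra_simps)
  then have "\<omega> ^ ((q + 1) div 2 * (q - 1)) * \<omega> ^ ((q + 1) div 2) = - (\<omega> ^ ((q + 1) div 2))"
    by simp
  then have "(\<omega> ^ ((q + 1) div 2)) ^ q = - (\<omega> ^ ((q + 1) div 2))"
    using q_gt_1 by (simp flip: power_add power_mult add: algebra_simps)
  then show ?thesis
    by (simp add: tr_eq_0_iff)
qed

text \<open>All such \<open>x\<close> are multiples of \<open>\<omega> ^ ((q + 1) div 2)\<close> by
  elements of \<open>F\<close>, where \<chi> is 1; and \<open>(q + 1) div 2\<close> and
  \<open>(q - 1) div 2\<close> have opposite parities.\<close>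

lemma quad_char_tr_zero:
  assumes "tr x = 0" "x \<noteq> 0"
  shows "\<chi> x = - \<epsilon>"
proof -
  let ?l = "\<omega> ^ ((q + 1) div 2)"
  have "(q + 1) div 2 = Suc ((q - 1) div 2)"
    using odd_q q_gt_1 by (auto elim!: oddE)
  then have "\<chi> ?l = - \<epsilon>"
    by (simp only: quad_char_power \<epsilon>_def) simp
  moreover have "x / ?l \<in> F" "x / ?l \<noteq> 0"
    using assms tr_zero_generator tr_zero_ratio generator_nonzero by auto
  then have "\<chi> (x / ?l) = 1"
    by (rule quad_char_F)
  then have "\<chi> (x / ?l * ?l) = \<chi> ?l"
    by (simp only: quad_char_mult mult_1)
  ultimately show ?thesis
    using generator_nonzero by simp
qed

section \<open>Scaling of sums over the two fields\<close>

lemma sum_F_scale: "t \<in> F \<Longrightarrow> t \<noteq> 0 \<Longrightarrow> (\<Sum>s\<in>F. f (t * s)) = (\<Sum>s\<in>F. f s)"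
  by (rule sum.reindex_bij_witness[of _ "\<lambda>s. s / t" "\<lambda>s. t * s"]) (auto intro: F_mult F_divide)

lemma sum_UNIV_scale: "t \<noteq> 0 \<Longrightarrow> (\<Sum>x\<in>UNIV. f (t * x)) = (\<Sum>x\<in>UNIV. f (x :: 'a))"
  by (rule sum.reindex_bij_witness[of _ "\<lambda>s. s / t" "\<lambda>s. t * s"]) auto

lemma sum_sub_char: "(\<Sum>s\<in>F. \<eta> s) = 0"
proof -
  have w: "\<omega> ^ (q + 1) \<in> F" "\<omega> ^ (q + 1) \<noteq> 0" "\<eta> (\<omega> ^ (q + 1)) = - 1"
    using norm_in_F generator_nonzero sub_char_power[of 1] by simp_all
  have "(\<Sum>s\<in>F. \<eta> s) = (\<Sum>s\<in>F. \<eta> (\<omega> ^ (q + 1) * s))"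
    using w(1,2) by (rule sum_F_scale[symmetric])
  also have "\<dots> = - (\<Sum>s\<in>F. \<eta> s)"
    using w by (simp add: sub_char_mult sum_negf del: power_Suc)
  finally show ?thesis
    by simp
qed

lemma sum_sub_char_nonzero: "(\<Sum>s\<in>F-{0}. \<eta> s) = 0"
  using sum_sub_char by (simp add: sum_diff1)

lemma sum_quad_char: "(\<Sum>x\<in>UNIV. \<chi> x) = 0"
proof -
  have "(\<Sum>x\<in>UNIV. \<chi> x) = (\<Sum>x\<in>UNIV. \<chi> (\<omega> * x))"
    using generator_nonzero by (rule sum_UNIV_scale[symmetric])
  also have "\<dots> = - (\<Sum>x\<in>UNIV. \<chi> x)"
    using quad_char_power[of 1] by (simp add: quad_char_mult sum_negf)
  finally show ?thesis
    by simp
qed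

end

section \<open>Additive characters and Gauss sums\<close>

text \<open>By \<open>psi_power_q\<close> the character factors through the relative trace. Sums are
  evaluated for any such character; the canonical one is shown to qualify later.\<close>

locale additive_character = quadratic_extension q \<omega>
  for q :: nat and \<omega> :: "'a::finite_field" +
  fixes \<psi> :: "'a \<Rightarrow> complex"
  assumes psi_add: "\<psi> (x + y) = \<psi> x * \<psi> y"
    and psi_0 [simp]: "\<psi> 0 = 1"
    and psi_power_q: "\<psi> (x ^ q) = \<psi> x"
    and psi_nontrivial: "\<exists>x. \<psi> x \<noteq> 1"
begin

text \<open>Invariance under \<open>x ^ q\<close> gives \<psi>(y) = \<psi>(-y) for y of trace zero.
  With y = x/2, the resulting \<psi>(y)^2 = 1 reads \<psi>(x) = 1.\<close>

lemma psi_tr_zero: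
  assumes "tr x = 0"
  shows "\<psi> x = 1"
proof -
  have double: "y / 2 + y / 2 = y" for y :: 'a
    using char_not_2 by (simp flip: mult_2)
  have "(2 :: 'a) \<in> F"
    using F_of_nat[of 2] by (simp del: F_of_nat)
  then have "tr (inverse 2 * x) = 0"
    using assms by (simp only: tr_scale F_inverse mult_zero_right)
  then have "tr (x / 2) = 0"
    by (simp only: divide_inverse mult.commute)
  then have "\<psi> (x / 2) = \<psi> (- (x / 2))"
    using psi_power_q[of "x / 2"] by (simp only: tr_eq_0_iff)
  then have "\<psi> (x / 2) * \<psi> (x / 2) = \<psi> (x / 2 + - (x / 2))"
    by (simp only: psi_add)
  then show ?thesis
    by (simp only: psi_add[symmetric] double) simp
qed

lemma psi_tr_eq:
  assumes "tr x = tr y"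
  shows "\<psi> x = \<psi> y"
proof -
  have "\<psi> x = \<psi> (x - y) * \<psi> y"
    by (simp flip: psi_add)
  then show ?thesis
    using assms by (simp add: psi_tr_zero tr_diff)
qed

lemma sum_psi: "(\<Sum>x\<in>UNIV. \<psi> (a * x)) = (if a = 0 then of_nat q ^ 2 else 0)"
proof (cases "a = 0")
  case False
  obtain t where t: "\<psi> t \<noteq> 1"
    using psi_nontrivial by blast
  have "(\<Sum>x\<in>UNIV. \<psi> (a * x)) = (\<Sum>x\<in>UNIV. \<psi> (x :: 'a))"
    using False by (rule sum_UNIV_scale)
  also have S: "(\<Sum>x\<in>UNIV. \<psi> x) = (\<Sum>x\<in>UNIV. \<psi> (x + t))"
    by (rule sum.reindex_bij_witness[of _ "\<lambda>x. x + t" "\<lambda>x. x - t"]) auto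
  then have "(\<Sum>x\<in>UNIV. \<psi> x) = (\<Sum>x\<in>UNIV. \<psi> x) * \<psi> t"
    unfolding psi_add sum_distrib_right[symmetric] .
  with t have "(\<Sum>x\<in>UNIV. \<psi> x) = 0"
    by simp
  finally show ?thesis
    using False by simp
qed (simp add: card_field)

lemma sum_psi_F: "(\<Sum>s\<in>F. \<psi> (s * x)) = (if tr x = 0 then of_nat q else 0)"
proof (cases "tr x = 0")
  case True
  then show ?thesis
    by (simp add: psi_tr_zero tr_scale card_F)
next
  case False
  obtain y where y: "\<psi> y \<noteq> 1"
    using psi_nontrivial by blast
  \<comment> \<open>With this scalar \<open>t * x\<close> has the trace of \<open>y\<close>, hence
    \<psi> is not 1 there; shifting \<open>s\<close> by \<open>t\<close> then forces the sum to
    vanish.\<close>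
  define t where "t = tr y / tr x"
  have t: "t \<in> F"
    unfolding t_def by (intro F_divide) auto
  then have "tr (t * x) = t * tr x"
    by (rule tr_scale)
  also have "\<dots> = tr y"
    using False by (simp add: t_def)
  finally have "tr (t * x) = tr y" .
  then have "\<psi> (t * x) \<noteq> 1"
    using y psi_tr_eq by metis
  moreover have "(\<Sum>s\<in>F. \<psi> (s * x)) = (\<Sum>s\<in>F. \<psi> ((s + t) * x))"
    by (rule sum.reindex_bij_witness[of _ "\<lambda>s. s + t" "\<lambda>s. s - t"]) (auto intro: F_add F_diff t)
  then have "(\<Sum>s\<in>F. \<psi> (s * x)) = (\<Sum>s\<in>F. \<psi> (s * x)) * \<psi> (t * x)"
    unfolding distrib_right psi_add sum_distrib_right[symmetric] .
  ultimately show ?thesis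
    using False by simp
qed

lemma sum_psi_F_nonzero:
  "(\<Sum>s\<in>F-{0}. \<psi> (s * x)) = (if tr x = 0 then of_nat q else 0) - 1"
  using sum_psi_F[of x] by (simp add: sum_diff1)

lemma kernel_tr:
  assumes "tr l = 0" "l \<noteq> 0"
  shows "{x. tr x = 0} = (\<lambda>s. s * l) ` F"
proof (intro equalityI subsetI)
  fix x assume "x \<in> {x. tr x = 0}"
  then have "x / l \<in> F" "x = x / l * l"
    using assms tr_zero_ratio by auto
  then show "x \<in> (\<lambda>s. s * l) ` F"
    by blast
qed (use assms in \<open>auto simp: tr_scale\<close>)

text \<open>Since \<chi> is 1 on the nonzero elements of \<open>F\<close>, the sum \<open>G\<close>
  can be averaged over scalings of its argument by them. The averaged phase detects the kernel of
  the trace, where \<chi> is constantly \<open>- \<epsilon>\<close> away from 0.\<close>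

lemma quad_gauss_sum: "(\<Sum>y\<in>UNIV. \<chi> y * \<psi> (b * y)) = - \<epsilon> * of_nat q * \<chi> b"
proof (cases "b = 0")
  case True
  then show ?thesis by (simp add: sum_quad_char)
next
  case False
  define G where "G = (\<Sum>y\<in>UNIV. \<chi> y * \<psi> y)"
  have scale: "(\<Sum>y\<in>UNIV. \<chi> y * \<psi> (c * y)) = \<chi> c * G" if "c \<noteq> 0" for c
  proof -
    have "\<chi> y * \<psi> (c * y) = \<chi> c * (\<chi> (c * y) * \<psi> (c * y))" for y
      unfolding quad_char_mult by (simp only: mult.assoc[symmetric] quad_char_square[OF that] mult_1)
    then have "(\<Sum>y\<in>UNIV. \<chi> y * \<psi> (c * y)) = \<chi> c * (\<Sum>y\<in>UNIV. \<chi> (c * y) * \<psi> (c * y))"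
      by (simp only: sum_distrib_left)
    also have "(\<Sum>y\<in>UNIV. \<chi> (c * y) * \<psi> (c * y)) = G"
      unfolding G_def using that by (rule sum_UNIV_scale)
    finally show ?thesis .
  qed
  let ?l = "\<omega> ^ ((q + 1) div 2)"
  have l: "tr ?l = 0" "?l \<noteq> 0"
    using tr_zero_generator generator_nonzero by auto
  have "of_nat (q - 1) * G = (\<Sum>s\<in>F-{0}. \<chi> s * G)"
    by (simp add: quad_char_F card_F_nonzero)
  also have "\<dots> = (\<Sum>s\<in>F-{0}. \<Sum>y\<in>UNIV. \<chi> y * \<psi> (s * y))"
    by (simp add: scale)
  also have "\<dots> = (\<Sum>y\<in>UNIV. \<chi> y * (\<Sum>s\<in>F-{0}. \<psi> (s * y)))"
    by (subst sum.swap) (simp add: sum_distrib_left)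
  also have "\<dots> = (\<Sum>y\<in>UNIV. (if tr y = 0 then of_nat q * \<chi> y else 0) - \<chi> y)"
    unfolding sum_psi_F_nonzero by (intro sum.cong) (auto simp: algebra_simps)
  also have "\<dots> = (\<Sum>y\<in>UNIV. if tr y = 0 then of_nat q * \<chi> y else 0)"
    by (simp add: sum_subtractf sum_quad_char)
  also have "\<dots> = of_nat q * (\<Sum>y\<in>{y. tr y = 0}. \<chi> y)"
    by (simp add: sum_distrib_left flip: sum.inter_filter)
  also have "(\<Sum>y\<in>{y. tr y = 0}. \<chi> y) = (\<Sum>y\<in>{y. tr y = 0}-{0}. \<chi> y)"
    by (simp add: sum_diff1)
  also have "\<dots> = (\<Sum>y\<in>{y. tr y = 0}-{0}. - \<epsilon>)"
    by (intro sum.cong) (auto simp: quad_char_tr_zero)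
  also have "\<dots> = of_nat (card ({y. tr y = 0} - {0})) * - \<epsilon>"
    by simp
  also have "card ({y. tr y = 0} - {0}) = q - 1"
    unfolding kernel_tr[OF l] using l(2) F_0
    by (subst card_Diff_singleton) (auto simp: card_image inj_on_def card_F intro!: image_eqI[of _ _ 0])
  finally have "of_nat (q - 1) * G = of_nat (q - 1) * (- \<epsilon> * of_nat q)"
    by (simp add: mult_ac)
  then have "G = - \<epsilon> * of_nat q"
    using q_gt_1 by (simp only: mult_cancel_left) simp
  then show ?thesis
    using scale[OF False] by simp
qed

text \<open>As 1 and \<open>z\<close> form a basis over \<open>F\<close>, the zero sum of \<chi>
  splits by the coefficient \<open>v\<close> of \<open>z\<close>. The line \<open>v = 0\<close>
  gives \<open>q - 1\<close>, and each of the other \<open>q - 1\<close> lines gives the unknown sum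
  after scaling by \<open>v\<close>.\<close>

lemma sum_quad_char_line:
  assumes "z \<notin> F"
  shows "(\<Sum>r\<in>F. \<chi> (r + z)) = - 1"
proof -
  let ?h = "\<lambda>(u, v). u + v * z"
  have inj: "inj_on ?h (F \<times> F)"
  proof (rule inj_onI, clarify)
    fix u v u' v' assume F: "u \<in> F" "v \<in> F" "u' \<in> F" "v' \<in> F"
      and eq: "u + v * z = u' + v' * z"
    have "v = v'"
    proof (rule ccontr)
      assume "v \<noteq> v'"
      with eq have "z = (u' - u) / (v - v')"
        by (simp add: field_simps)
      with F assms show False
        by (metis F_diff F_divide)
    qed
    with eq show "u = u' \<and> v = v'" by simp
  qed
  then have "card (?h ` (F \<times> F)) = CARD('a)"
    by (simp add: card_image card_cartesian_product card_F card_field power2_eq_square)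
  then have "?h ` (F \<times> F) = UNIV"
    by (intro card_subset_eq) auto
  then have "bij_betw ?h (F \<times> F) UNIV"
    using inj by (simp add: bij_betw_def)
  then have "(\<Sum>p\<in>F\<times>F. \<chi> (?h p)) = 0"
    by (simp add: sum.reindex_bij_betw[where g = \<chi>] sum_quad_char)
  then have "0 = (\<Sum>u\<in>F. \<Sum>v\<in>F. \<chi> (u + v * z))"
    by (simp add: sum.cartesian_product split_beta)
  also have "\<dots> = (\<Sum>v\<in>F. \<Sum>u\<in>F. \<chi> (u + v * z))"
    by (rule sum.swap)
  also have "\<dots> = (\<Sum>u\<in>F. \<chi> u) + (\<Sum>v\<in>F-{0}. \<Sum>u\<in>F. \<chi> (u + v * z))"
    by (subst sum.remove[of _ 0]) auto
  also have "(\<Sum>u\<in>F. \<chi> u) = (\<Sum>u\<in>F-{0}. \<chi> u)"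
    by (simp add: sum_diff1)
  also have "\<dots> = of_nat (q - 1)"
    by (simp add: quad_char_F card_F_nonzero)
  also have "(\<Sum>v\<in>F-{0}. \<Sum>u\<in>F. \<chi> (u + v * z)) = (\<Sum>v\<in>F-{0}. \<Sum>u\<in>F. \<chi> (u + z))"
  proof (rule sum.cong)
    fix v assume v: "v \<in> F - {0}"
    have "(\<Sum>u\<in>F. \<chi> (u + v * z)) = (\<Sum>u\<in>F. \<chi> (v * u + v * z))"
      using v sum_F_scale[of v "\<lambda>u. \<chi> (u + v * z)"] by simp
    also have "\<dots> = (\<Sum>u\<in>F. \<chi> (v * (u + z)))"
      by (simp add: algebra_simps)
    also have "\<dots> = (\<Sum>u\<in>F. \<chi> (u + z))"
      using v by (simp add: quad_char_mult quad_char_F)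
    finally show "(\<Sum>u\<in>F. \<chi> (u + v * z)) = (\<Sum>u\<in>F. \<chi> (u + z))" .
  qed simp
  finally have "of_nat (q - 1) * (1 + (\<Sum>u\<in>F. \<chi> (u + z))) = 0"
    by (simp add: card_F_nonzero algebra_simps)
  then show ?thesis
    using q_gt_1 by (simp add: add_eq_0_iff neg_eq_iff_add_eq_0 del: of_nat_diff)
qed

text \<open>The quadratic Gauss sum of the small field: as \<open>inverse 2\<close> has trace one,
  \<open>\<psi> (s * inverse 2)\<close> is the additive character of \<open>F\<close> from which
  \<psi> is lifted by the trace.\<close>

definition gauss :: complex where "gauss = (\<Sum>s\<in>F. \<eta> s * \<psi> (s * inverse 2))"

text \<open>Rewrites \<eta> of a trace as a combination of additive phases; this is the device
  behind the transforms of \<eta> below.\<close>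

lemma sub_gauss_sum: "(\<Sum>s\<in>F. \<eta> s * \<psi> (s * x)) = gauss * \<eta> (tr x)"
proof (cases "tr x = 0")
  case True
  then have "(\<Sum>s\<in>F. \<eta> s * \<psi> (s * x)) = (\<Sum>s\<in>F. \<eta> s)"
    by (simp add: psi_tr_zero tr_scale)
  then show ?thesis
    using True by (simp add: sum_sub_char)
next
  case False
  \<comment> \<open>Both arguments of \<psi> have trace \<open>s * tr x\<close>, and \<psi> depends
    on the trace only.\<close>
  have "(\<Sum>s\<in>F. \<eta> s * \<psi> (s * x)) = (\<Sum>s\<in>F. \<eta> s * \<psi> ((tr x * s) * inverse 2))"
    by (intro sum.cong arg_cong2[of _ _ _ _ "(*)"] psi_tr_eq refl)
       (simp only: tr_scale F_mult tr_in_F tr_half mult_1_right, simp only: mult.commute)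
  also have "\<dots> = (\<Sum>s\<in>F. \<eta> (tr x) * (\<eta> (tr x * s) * \<psi> ((tr x * s) * inverse 2)))"
    using sub_char_square[OF False] by (intro sum.cong) (auto simp: sub_char_mult simp flip: mult.assoc)
  also have "\<dots> = \<eta> (tr x) * (\<Sum>s\<in>F. \<eta> (tr x * s) * \<psi> ((tr x * s) * inverse 2))"
    by (simp only: sum_distrib_left)
  also have "(\<Sum>s\<in>F. \<eta> (tr x * s) * \<psi> ((tr x * s) * inverse 2)) = gauss"
    unfolding gauss_def using tr_in_F False by (rule sum_F_scale)
  finally show ?thesis
    by (simp only: mult.commute)
qed

lemma sum_F_zero_cong: "f 0 = 0 \<Longrightarrow> (\<Sum>s\<in>F. f s) = (\<Sum>s\<in>F-{0}. f s :: complex)"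
  by (simp add: sum_diff1)

text \<open>Writing the second variable as \<open>s * t\<close> cancels \<eta>(s) and leaves a phase
  linear in \<open>s\<close>; summing over \<open>s\<close> singles out
  \<open>t = - 1\<close>.\<close>

lemma gauss_square: "gauss * gauss = \<epsilon> * of_nat q"
proof -
  have "gauss * gauss = (\<Sum>s\<in>F-{0}. \<eta> s * \<psi> (s * inverse 2)) * gauss"
    by (simp add: gauss_def sum_F_zero_cong)
  also have "\<dots> = (\<Sum>s\<in>F-{0}. \<Sum>t\<in>F. \<eta> s * \<psi> (s * inverse 2) * (\<eta> (s * t) * \<psi> (s * t * inverse 2)))"
    unfolding sum_distrib_right
  proof (rule sum.cong)
    fix s assume s: "s \<in> F - {0}"
    then have "gauss = (\<Sum>t\<in>F. \<eta> (s * t) * \<psi> (s * t * inverse 2))"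
      unfolding gauss_def by (intro sum_F_scale[symmetric]) auto
    then show "\<eta> s * \<psi> (s * inverse 2) * gauss
        = (\<Sum>t\<in>F. \<eta> s * \<psi> (s * inverse 2) * (\<eta> (s * t) * \<psi> (s * t * inverse 2)))"
      by (simp only: sum_distrib_left)
  qed simp
  also have "\<dots> = (\<Sum>s\<in>F-{0}. \<Sum>t\<in>F. \<eta> t * \<psi> (s * ((1 + t) * inverse 2)))"
  proof (intro sum.cong refl)
    fix s t assume st: "s \<in> F - {0}" "t \<in> F"
    then have "\<eta> s * \<psi> (s * inverse 2) * (\<eta> (s * t) * \<psi> (s * t * inverse 2))
        = \<eta> s * \<eta> s * \<eta> t * (\<psi> (s * inverse 2) * \<psi> (s * t * inverse 2))"
      by (simp add: sub_char_mult)
    also have "\<eta> s * \<eta> s = 1"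
      using st by (intro sub_char_square) auto
    also have "\<psi> (s * inverse 2) * \<psi> (s * t * inverse 2) = \<psi> (s * ((1 + t) * inverse 2))"
      by (simp only: psi_add[symmetric]) (simp only: algebra_simps mult_1)
    finally show "\<eta> s * \<psi> (s * inverse 2) * (\<eta> (s * t) * \<psi> (s * t * inverse 2))
        = \<eta> t * \<psi> (s * ((1 + t) * inverse 2))"
      by simp
  qed
  also have "\<dots> = (\<Sum>t\<in>F. \<eta> t * (\<Sum>s\<in>F-{0}. \<psi> (s * ((1 + t) * inverse 2))))"
    by (subst sum.swap) (simp only: sum_distrib_left)
  also have "\<dots> = (\<Sum>t\<in>F. \<eta> t * ((if t = - 1 then of_nat q else 0) - 1))"
  proof (rule sum.cong)
    fix t assume t: "t \<in> F"
    then have "tr ((1 + t) * inverse 2) = 1 + t"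
      by (simp only: tr_scale F_add F_1 tr_half mult_1_right)
    then have "tr ((1 + t) * inverse 2) = 0 \<longleftrightarrow> t = - 1"
      by (simp only: add_eq_0_iff)
    then show "\<eta> t * (\<Sum>s\<in>F-{0}. \<psi> (s * ((1 + t) * inverse 2)))
        = \<eta> t * ((if t = - 1 then of_nat q else 0) - 1)"
      by (simp only: sum_psi_F_nonzero)
  qed simp
  also have "\<dots> = (\<Sum>t\<in>F. if t = - 1 then \<eta> t * of_nat q else 0) - (\<Sum>t\<in>F. \<eta> t)"
    unfolding sum_subtractf[symmetric] by (intro sum.cong) (auto simp: algebra_simps)
  also have "\<dots> = \<epsilon> * of_nat q"
    by (subst sum.delta) (simp_all add: sum_sub_char sub_char_minus_1)
  finally show ?thesis .
qed

lemma gauss_nonzero: "gauss \<noteq> 0"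
proof
  assume "gauss = 0"
  then have "\<epsilon> * of_nat q = 0"
    using gauss_square by simp
  then show False
    using q_gt_1 eps_cases by auto
qed

text \<open>Summation over \<open>V\<close> forces \<open>\<theta> * U + b = 0\<close>, so a single
  \<open>U\<close> survives.\<close>

lemma sum_psi_hyperbolic:
  assumes "\<theta> \<noteq> 0"
  shows "(\<Sum>U\<in>UNIV. \<Sum>V\<in>UNIV. \<psi> (\<theta> * (U * V)) * \<psi> (a * U + b * V))
    = of_nat q ^ 2 * \<psi> (- (a * b / \<theta>))"
proof -
  have "(\<Sum>U\<in>UNIV. \<Sum>V\<in>UNIV. \<psi> (\<theta> * (U * V)) * \<psi> (a * U + b * V))
      = (\<Sum>U\<in>UNIV. \<Sum>V\<in>UNIV. \<psi> (a * U) * \<psi> ((\<theta> * U + b) * V))"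
    by (intro sum.cong refl) (simp add: algebra_simps flip: psi_add)
  also have "\<dots> = (\<Sum>U\<in>UNIV. \<psi> (a * U) * (if \<theta> * U + b = 0 then of_nat q ^ 2 else 0))"
    by (simp only: sum_distrib_left[symmetric] sum_psi)
  also have "\<dots> = (\<Sum>U\<in>UNIV. if U = - (b / \<theta>) then \<psi> (a * U) * of_nat q ^ 2 else 0)"
  proof (intro sum.cong refl)
    fix U
    have "\<theta> * U + b = 0 \<longleftrightarrow> U = - (b / \<theta>)"
      using assms by (auto simp: field_simps add_eq_0_iff)
    then show "\<psi> (a * U) * (if \<theta> * U + b = 0 then of_nat q ^ 2 else 0)
        = (if U = - (b / \<theta>) then \<psi> (a * U) * of_nat q ^ 2 else 0)"
      by simp
  qed
  also have "\<dots> = of_nat q ^ 2 * \<psi> (- (a * b / \<theta>))"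
    by (simp add: sum.delta)
  finally show ?thesis .
qed

text \<open>The Gauss sum expands \<eta> into phases with parameters \<open>s * \<theta>\<close>,
  whose transforms have parameters \<open>inverse s\<close>. As \<eta>(s) is unchanged by inversion,
  renaming \<open>s\<close> restores a Gauss sum, now at \<open>- (a * b / \<theta>)\<close>; the
  minus sign produces \<epsilon>.\<close>

lemma transform_eta:
  assumes "\<theta> \<noteq> 0"
  shows "(\<Sum>U\<in>UNIV. \<Sum>V\<in>UNIV. \<eta> (tr (\<theta> * (U * V))) * \<psi> (a * U + b * V))
    = of_nat q ^ 2 * \<epsilon> * \<eta> (tr (a * b / \<theta>))"
proof -
  let ?d = "a * b / \<theta>"
  let ?S = "\<Sum>U\<in>UNIV. \<Sum>V\<in>UNIV. \<eta> (tr (\<theta> * (U * V))) * \<psi> (a * U + b * V)"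
  have "gauss * ?S
      = (\<Sum>U\<in>UNIV. \<Sum>V\<in>UNIV. \<Sum>s\<in>F. \<eta> s * (\<psi> (s * (\<theta> * (U * V))) * \<psi> (a * U + b * V)))"
    by (simp only: sum_distrib_left mult.assoc[symmetric] sub_gauss_sum[symmetric] sum_distrib_right)
  also have "\<dots> = (\<Sum>U\<in>UNIV. \<Sum>s\<in>F. \<Sum>V\<in>UNIV. \<eta> s * (\<psi> (s * (\<theta> * (U * V))) * \<psi> (a * U + b * V)))"
    by (intro sum.cong refl sum.swap)
  also have "\<dots> = (\<Sum>s\<in>F. \<Sum>U\<in>UNIV. \<Sum>V\<in>UNIV. \<eta> s * (\<psi> (s * (\<theta> * (U * V))) * \<psi> (a * U + b * V)))"
    by (rule sum.swap)
  also have "\<dots> = (\<Sum>s\<in>F-{0}. \<eta> s * (\<Sum>U\<in>UNIV. \<Sum>V\<in>UNIV. \<psi> (s * \<theta> * (U * V)) * \<psi> (a * U + b * V)))"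
    by (subst sum_F_zero_cong) (simp_all add: sum_distrib_left mult.assoc)
  also have "\<dots> = (\<Sum>s\<in>F-{0}. \<eta> (inverse s) * (of_nat q ^ 2 * \<psi> (inverse s * - ?d)))"
  proof (rule sum.cong)
    fix s assume s: "s \<in> F - {0}"
    then have "(\<Sum>U\<in>UNIV. \<Sum>V\<in>UNIV. \<psi> (s * \<theta> * (U * V)) * \<psi> (a * U + b * V))
        = of_nat q ^ 2 * \<psi> (- (a * b / (s * \<theta>)))"
      using assms by (intro sum_psi_hyperbolic) auto
    also have "- (a * b / (s * \<theta>)) = inverse s * - ?d"
      using s assms by (simp add: field_simps)
    finally show "\<eta> s * (\<Sum>U\<in>UNIV. \<Sum>V\<in>UNIV. \<psi> (s * \<theta> * (U * V)) * \<psi> (a * U + b * V))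
        = \<eta> (inverse s) * (of_nat q ^ 2 * \<psi> (inverse s * - ?d))"
      using s by (simp add: sub_char_inverse)
  qed simp
  also have "\<dots> = (\<Sum>s\<in>F-{0}. \<eta> s * (of_nat q ^ 2 * \<psi> (s * - ?d)))"
    by (rule sum.reindex_bij_witness[of _ inverse inverse]) auto
  also have "\<dots> = of_nat q ^ 2 * (\<Sum>s\<in>F-{0}. \<eta> s * \<psi> (s * - ?d))"
    by (simp add: sum_distrib_left mult_ac)
  also have "(\<Sum>s\<in>F-{0}. \<eta> s * \<psi> (s * - ?d)) = gauss * \<eta> (tr (- ?d))"
    by (subst sub_gauss_sum[symmetric]) (simp add: sum_F_zero_cong)
  also have "\<eta> (tr (- ?d)) = \<epsilon> * \<eta> (tr ?d)"
    by (simp only: tr_uminus sub_char_uminus tr_in_F)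
  finally have "gauss * ?S = gauss * (of_nat q ^ 2 * \<epsilon> * \<eta> (tr ?d))"
    by (simp only: ac_simps)
  then show ?thesis
    using gauss_nonzero by (simp only: mult_cancel_left) simp
qed

end

section \<open>Transforms of quadratic characters of bilinear forms\<close>

context additive_character
begin

lemma quad_nonresidue_notin_F: "\<chi> \<theta> = - 1 \<Longrightarrow> \<theta> \<notin> F"
  using quad_char_F[of \<theta>] by (cases "\<theta> = 0") auto

lemma tr_divide: "x \<noteq> 0 \<Longrightarrow> tr (y / x) = tr (y * x ^ q) / x ^ (q + 1)"
proof -
  assume "x \<noteq> 0"
  then have "y / x = inverse (x ^ (q + 1)) * (y * x ^ q)"
    by (simp add: field_simps)
  then have "tr (y / x) = inverse (x ^ (q + 1)) * tr (y * x ^ q)"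
    by (simp only: tr_scale F_inverse norm_in_F)
  then show ?thesis
    by (simp only: divide_inverse mult.commute)
qed

text \<open>Extending the fraction by the conjugate \<open>x ^ q\<close> leaves the norm of
  \<open>x\<close> in the denominator, and \<eta> of the norm is \<chi>.\<close>

lemma sub_char_tr_divide: "\<eta> (tr (y / x)) = \<chi> x * \<eta> (tr (y * x ^ q))"
proof (cases "x = 0")
  case False
  show ?thesis
    unfolding tr_divide[OF False] sub_char_divide[OF tr_in_F norm_in_F] quad_char_norm
    by (rule mult.commute)
qed simp

text \<open>If \<open>B\<close> is nonzero only \<open>t = - (A / B)\<close> survives; if
  \<open>B = 0\<close> either no term survives or the full, vanishing sum of \<eta> remains.\<close>

lemma sum_sub_char_linear:
  assumes "A \<in> F" "B \<in> F"
  shows "(\<Sum>t\<in>F. if A + t * B = 0 then \<eta> t else 0) = \<epsilon> * \<eta> A * \<eta> B"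
proof (cases "B = 0")
  case True
  then show ?thesis
    by (cases "A = 0") (simp_all add: sum_sub_char)
next
  case False
  then have "A + t * B = 0 \<longleftrightarrow> t = - (A / B)" for t
    by (auto simp: field_simps add_eq_0_iff)
  moreover have "- (A / B) \<in> F"
    using assms by (simp add: F_divide)
  ultimately show ?thesis
    using assms by (simp add: sub_char_uminus F_divide sub_char_divide)
qed

text \<open>Two Gauss sums give phases with parameters \<open>s + t * \<theta>\<close>, which are
  nonzero for \<open>s \<noteq> 0\<close> because \<theta> is outside \<open>F\<close>. Summing over
  the scale \<open>s\<close> leaves the condition that \<open>a * b / (1 + t * \<theta>)\<close> has
  trace zero, which is affine in \<open>t\<close> after conjugating the denominator. The final sign
  comes from \<chi>(\<theta>) = -1.\<close>

lemma transform_eta_eta: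
  assumes "\<chi> \<theta> = - 1"
  shows "(\<Sum>U\<in>UNIV. \<Sum>V\<in>UNIV. \<eta> (tr (U * V)) * \<eta> (tr (\<theta> * (U * V))) * \<psi> (a * U + b * V))
    = - (of_nat q ^ 2 * \<eta> (tr (a * b)) * \<eta> (tr (a * b / \<theta>)))"
proof -
  let ?S = "\<Sum>U\<in>UNIV. \<Sum>V\<in>UNIV. \<eta> (tr (U * V)) * \<eta> (tr (\<theta> * (U * V))) * \<psi> (a * U + b * V)"
  let ?A = "tr (a * b)" and ?B = "tr (a * b * \<theta> ^ q)"
  define H where "H \<kappa> = (\<Sum>U\<in>UNIV. \<Sum>V\<in>UNIV. \<psi> (\<kappa> * (U * V)) * \<psi> (a * U + b * V))" for \<kappa>
  have nz: "1 + t * \<theta> \<noteq> 0" if "t \<in> F" for t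
  proof
    assume "1 + t * \<theta> = 0"
    then have "t * \<theta> = - 1"
      by (simp add: add_eq_0_iff)
    then have "\<theta> = - (1 / t)"
      by (cases "t = 0") (auto simp: field_simps)
    with that have "\<theta> \<in> F"
      by (simp add: F_divide)
    with quad_nonresidue_notin_F[OF assms] show False ..
  qed
  have "gauss * gauss * ?S
      = (\<Sum>U\<in>UNIV. \<Sum>V\<in>UNIV. (gauss * \<eta> (tr (U * V))) * (gauss * \<eta> (tr (\<theta> * (U * V)))) * \<psi> (a * U + b * V))"
    unfolding sum_distrib_left by (intro sum.cong refl) (simp only: ac_simps)
  also have "\<dots> = (\<Sum>U\<in>UNIV. \<Sum>V\<in>UNIV. \<Sum>s\<in>F. \<Sum>t\<in>F.
      \<eta> s * \<eta> t * (\<psi> ((s + t * \<theta>) * (U * V)) * \<psi> (a * U + b * V)))"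
    unfolding sub_gauss_sum[symmetric] sum_product
    unfolding sum_distrib_right
    by (intro sum.cong refl) (simp only: distrib_right psi_add, simp only: ac_simps)
  also have "\<dots> = (\<Sum>U\<in>UNIV. \<Sum>s\<in>F. \<Sum>V\<in>UNIV. \<Sum>t\<in>F.
      \<eta> s * \<eta> t * (\<psi> ((s + t * \<theta>) * (U * V)) * \<psi> (a * U + b * V)))"
    by (intro sum.cong refl sum.swap)
  also have "\<dots> = (\<Sum>s\<in>F. \<Sum>U\<in>UNIV. \<Sum>V\<in>UNIV. \<Sum>t\<in>F.
      \<eta> s * \<eta> t * (\<psi> ((s + t * \<theta>) * (U * V)) * \<psi> (a * U + b * V)))"
    by (rule sum.swap)
  also have "\<dots> = (\<Sum>s\<in>F. \<Sum>U\<in>UNIV. \<Sum>t\<in>F. \<Sum>V\<in>UNIV.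
      \<eta> s * \<eta> t * (\<psi> ((s + t * \<theta>) * (U * V)) * \<psi> (a * U + b * V)))"
    by (intro sum.cong refl sum.swap)
  also have "\<dots> = (\<Sum>s\<in>F. \<Sum>t\<in>F. \<Sum>U\<in>UNIV. \<Sum>V\<in>UNIV.
      \<eta> s * \<eta> t * (\<psi> ((s + t * \<theta>) * (U * V)) * \<psi> (a * U + b * V)))"
    by (intro sum.cong refl sum.swap)
  also have "\<dots> = (\<Sum>s\<in>F. \<Sum>t\<in>F. \<eta> s * \<eta> t * H (s + t * \<theta>))"
    by (simp only: H_def sum_distrib_left)
  also have "\<dots> = (\<Sum>s\<in>F-{0}. \<Sum>t\<in>F. \<eta> s * \<eta> t * H (s + t * \<theta>))"
    by (rule sum_F_zero_cong) simp
  \<comment> \<open>Replacing \<open>t\<close> by \<open>s * t\<close> makes \<open>s\<close> a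
    common factor of the parameter and lets \<eta>(s) occur squared.\<close>
  also have "\<dots> = (\<Sum>s\<in>F-{0}. \<Sum>t\<in>F. \<eta> s * \<eta> (s * t) * H (s + s * t * \<theta>))"
    by (intro sum.cong refl sum_F_scale[symmetric]) auto
  also have "\<dots> = (\<Sum>s\<in>F-{0}. \<Sum>t\<in>F. of_nat q ^ 2 * (\<eta> t * \<psi> (inverse s * - (a * b / (1 + t * \<theta>)))))"
  proof (intro sum.cong refl)
    fix s t assume st: "s \<in> F - {0}" "t \<in> F"
    have "H (s + s * t * \<theta>) = of_nat q ^ 2 * \<psi> (- (a * b / (s + s * t * \<theta>)))"
      unfolding H_def
    proof (rule sum_psi_hyperbolic)
      have "s + s * t * \<theta> = s * (1 + t * \<theta>)"
        by (simp add: algebra_simps)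
      then show "s + s * t * \<theta> \<noteq> 0"
        using nz[OF st(2)] st by simp
    qed
    also have "- (a * b / (s + s * t * \<theta>)) = inverse s * - (a * b / (1 + t * \<theta>))"
    proof -
      have "s + s * t * \<theta> = s * (1 + t * \<theta>)"
        by (simp add: algebra_simps)
      then show ?thesis
        by (simp add: divide_inverse mult_ac)
    qed
    also have "\<eta> s * \<eta> (s * t) = \<eta> t"
      using st sub_char_square[of s] by (simp add: sub_char_mult flip: mult.assoc)
    ultimately show "\<eta> s * \<eta> (s * t) * H (s + s * t * \<theta>)
        = of_nat q ^ 2 * (\<eta> t * \<psi> (inverse s * - (a * b / (1 + t * \<theta>))))"
      by (simp only: ac_simps)
  qed
  also have "\<dots> = (\<Sum>s\<in>F-{0}. \<Sum>t\<in>F. of_nat q ^ 2 * (\<eta> t * \<psi> (s * - (a * b / (1 + t * \<theta>)))))"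
    by (rule sum.reindex_bij_witness[of _ inverse inverse]) auto
  also have "\<dots> = of_nat q ^ 2 * (\<Sum>t\<in>F. \<eta> t * (\<Sum>s\<in>F-{0}. \<psi> (s * - (a * b / (1 + t * \<theta>)))))"
    by (subst sum.swap) (simp only: sum_distrib_left)
  also have "(\<Sum>t\<in>F. \<eta> t * (\<Sum>s\<in>F-{0}. \<psi> (s * - (a * b / (1 + t * \<theta>)))))
      = (\<Sum>t\<in>F. of_nat q * (if ?A + t * ?B = 0 then \<eta> t else 0) - \<eta> t)"
  proof (rule sum.cong)
    fix t assume t: "t \<in> F"
    have "a * b * (1 + t * \<theta>) ^ q = a * b + t * (a * b * \<theta> ^ q)"
      using t by (simp add: frobenius_add power_mult_distrib subfield_iff algebra_simps)
    then have "tr (a * b * (1 + t * \<theta>) ^ q) = ?A + t * ?B"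
      using t by (simp add: tr_add tr_scale)
    then have "tr (- (a * b / (1 + t * \<theta>))) = 0 \<longleftrightarrow> ?A + t * ?B = 0"
      using nz[OF t] by (simp add: tr_divide del: power_Suc)
    then show "\<eta> t * (\<Sum>s\<in>F-{0}. \<psi> (s * - (a * b / (1 + t * \<theta>))))
        = of_nat q * (if ?A + t * ?B = 0 then \<eta> t else 0) - \<eta> t"
      unfolding sum_psi_F_nonzero by (simp add: algebra_simps)
  qed simp
  also have "\<dots> = of_nat q * (\<epsilon> * \<eta> ?A * \<eta> ?B)"
    by (simp only: sum_subtractf sum_distrib_left[symmetric] sum_sub_char sum_sub_char_linear tr_in_F) simp
  also have "\<eta> ?B = - \<eta> (tr (a * b / \<theta>))"
    by (simp add: sub_char_tr_divide assms)
  finally have "\<epsilon> * of_nat q * ?S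
      = \<epsilon> * of_nat q * - (of_nat q ^ 2 * \<eta> (tr (a * b)) * \<eta> (tr (a * b / \<theta>)))"
    unfolding gauss_square by (simp add: algebra_simps)
  moreover have "\<epsilon> * of_nat q \<noteq> 0"
    using q_gt_1 eps_cases by auto
  ultimately show ?thesis
    by (simp only: mult_cancel_left) simp
qed

text \<open>Transform of \<chi>(U) on the pairs with \<open>U * V\<close> in the square class of
  \<open>l\<close>. For \<open>tr l = 0\<close> these pairs lie on the quadric
  \<open>tr (U * V) = 0\<close>.\<close>

definition twisted_sum :: "'a \<Rightarrow> 'a \<Rightarrow> 'a \<Rightarrow> complex"
  where "twisted_sum l a b =
    (\<Sum>U\<in>UNIV. \<Sum>V\<in>UNIV. \<chi> U * of_bool (U * V / l \<in> nonzero_squares q) * \<psi> (a * U + b * V))"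

lemma of_bool_square: "x \<in> F \<Longrightarrow> x \<noteq> 0 \<Longrightarrow> of_bool (x \<in> nonzero_squares q) = (1 + \<eta> x) / 2"
  by (simp add: sub_char_def)

lemma sum_UNIV_power_q: "(\<Sum>x\<in>UNIV. f (x ^ q)) = (\<Sum>x\<in>UNIV. f (x :: 'a))"
  by (rule sum.reindex_bij_witness[of _ "\<lambda>x. x ^ q" "\<lambda>x. x ^ q"]) (auto simp: power_q_q)

text \<open>For \<open>V \<noteq> 0\<close> the contributing \<open>U\<close> are among the
  \<open>l * r * V ^ q\<close> with \<open>r\<close> in \<open>F\<close>. There \<chi>(U) times the
  indicator is \<chi>(l) (\<chi>(V) + \<eta>(r)) / 2; summed over \<open>V\<close>, the first term
  gives a Gauss sum and the second detects zeros of \<open>a * l * r + b ^ q\<close>.\<close>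

lemma twisted_sum_eq:
  assumes l: "tr l = 0" "l \<noteq> 0"
  shows "twisted_sum l a b = of_nat q / 2 * (\<Sum>r\<in>F-{0}. \<chi> (a * l * r + b ^ q))
    - \<epsilon> * of_nat q ^ 2 / 2 * (\<Sum>r\<in>F-{0}. if a * l * r + b ^ q = 0 then \<eta> r else 0)"
proof -
  let ?t = "\<lambda>r. a * l * r + b ^ q"
  let ?g = "\<lambda>U V. \<chi> U * of_bool (U * V / l \<in> nonzero_squares q) * \<psi> (a * U + b * V)"
  \<comment> \<open>The correction \<open>of_bool (V ^ q = 0)\<close> makes the summand vanish at
    \<open>V = 0\<close>, so one formula serves all \<open>V\<close>.\<close>
  have inner: "(\<Sum>U\<in>UNIV. ?g U V)
      = (\<Sum>r\<in>F-{0}. \<chi> l / 2 * (\<chi> (V ^ q) * \<psi> (?t r * V ^ q) + \<eta> r * (\<psi> (?t r * V ^ q) - of_bool (V ^ q = 0))))"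
    (is "_ = (\<Sum>r\<in>F-{0}. ?h r)") for V
  proof (cases "V = 0")
    case True
    then show ?thesis
      using q_gt_1 nonzero_squares_subset by (auto simp: power_0_left)
  next
    case V: False
    have supp: "?g U V = 0" if "U \<notin> (\<lambda>r. l * r * V ^ q) ` (F - {0})" for U
    proof -
      have "U * V / l \<notin> nonzero_squares q"
      proof
        assume "U * V / l \<in> nonzero_squares q"
        then have r: "U * V / l \<in> F - {0}"
          using nonzero_squares_subset by blast
        have "U = l * (U * V / l / V ^ (q + 1)) * V ^ q"
          using V l by (simp add: field_simps)
        moreover have "U * V / l / V ^ (q + 1) \<in> F - {0}"
        proof -
          have "U * V / l \<in> F"
            using r by blast
          then have "U * V / l / V ^ (q + 1) \<in> F"
            using norm_in_F by (rule F_divide)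
          then show ?thesis
            using r V by simp
        qed
        ultimately show False
          using that by blast
      qed
      then show ?thesis by simp
    qed
    have "(\<Sum>U\<in>UNIV. ?g U V) = (\<Sum>U\<in>(\<lambda>r. l * r * V ^ q) ` (F - {0}). ?g U V)"
      using supp by (intro sum.mono_neutral_right) auto
    also have "\<dots> = (\<Sum>r\<in>F-{0}. ?g (l * r * V ^ q) V)"
      using V l by (subst sum.reindex) (auto simp: inj_on_def)
    also have "\<dots> = (\<Sum>r\<in>F-{0}. ?h r)"
    proof (rule sum.cong)
      fix r assume r: "r \<in> F - {0}"
      have e: "l * r * V ^ q * V / l = r * V ^ (q + 1)"
        using l by simp
      have "of_bool (l * r * V ^ q * V / l \<in> nonzero_squares q) = (1 + \<eta> (r * V ^ (q + 1))) / 2"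
        unfolding e using r V F_mult norm_in_F[of V] by (intro of_bool_square) auto
      also have "\<eta> (r * V ^ (q + 1)) = \<eta> r * \<chi> V"
        using r norm_in_F[of V] by (simp only: quad_char_norm sub_char_mult Diff_iff)
      finally have 1: "of_bool (l * r * V ^ q * V / l \<in> nonzero_squares q) = (1 + \<eta> r * \<chi> V) / 2" .
      have 2: "\<chi> (l * r * V ^ q) = \<chi> l * \<chi> V"
        using r by (simp add: quad_char_mult quad_char_F quad_char_power_q)
      \<comment> \<open>The term in \<open>b\<close> is conjugated so that both phases become
        multiples of \<open>V ^ q\<close>.\<close>
      have "\<psi> (b * V) = \<psi> (b ^ q * V ^ q)"
        by (simp only: psi_power_q power_mult_distrib[symmetric])
      then have 3: "\<psi> (a * (l * r * V ^ q) + b * V) = \<psi> (?t r * V ^ q)"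
        by (simp add: psi_add algebra_simps)
      show "?g (l * r * V ^ q) V = ?h r"
        unfolding 1 2 3 using V quad_char_square[OF V] by (simp add: quad_char_power_q algebra_simps)
    qed simp
    finally show ?thesis .
  qed
  have "twisted_sum l a b = (\<Sum>V\<in>UNIV. \<Sum>U\<in>UNIV. ?g U V)"
    unfolding twisted_sum_def by (rule sum.swap)
  also have "\<dots> = (\<Sum>V\<in>UNIV. \<Sum>r\<in>F-{0}. \<chi> l / 2 * (\<chi> V * \<psi> (?t r * V) + \<eta> r * (\<psi> (?t r * V) - of_bool (V = 0))))"
    unfolding inner by (rule sum_UNIV_power_q)
  also have "\<dots> = (\<Sum>r\<in>F-{0}. \<Sum>V\<in>UNIV. \<chi> l / 2 * (\<chi> V * \<psi> (?t r * V) + \<eta> r * (\<psi> (?t r * V) - of_bool (V = 0))))"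
    by (rule sum.swap)
  \<comment> \<open>The last summand stems from the correction at \<open>V = 0\<close>; it
    disappears because \<eta> sums to zero.\<close>
  also have "\<dots> = (\<Sum>r\<in>F-{0}. of_nat q / 2 * \<chi> (?t r)
      - \<epsilon> * of_nat q ^ 2 / 2 * (if ?t r = 0 then \<eta> r else 0) + \<epsilon> / 2 * \<eta> r)"
  proof (rule sum.cong)
    fix r assume "r \<in> F - {0}"
    have "(\<Sum>V\<in>UNIV. \<chi> l / 2 * (\<chi> V * \<psi> (?t r * V) + \<eta> r * (\<psi> (?t r * V) - of_bool (V = 0))))
      = \<chi> l / 2 * ((\<Sum>V\<in>UNIV. \<chi> V * \<psi> (?t r * V))
          + \<eta> r * ((\<Sum>V\<in>UNIV. \<psi> (?t r * V)) - (\<Sum>V\<in>UNIV. of_bool (V = (0 :: 'a)))))"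
      by (simp only: sum_distrib_left[symmetric] sum.distrib sum_subtractf)
    also have "(\<Sum>V\<in>UNIV. of_bool (V = (0 :: 'a))) = (1 :: complex)"
      by (simp add: of_bool_def)
    finally show "(\<Sum>V\<in>UNIV. \<chi> l / 2 * (\<chi> V * \<psi> (?t r * V) + \<eta> r * (\<psi> (?t r * V) - of_bool (V = 0))))
      = of_nat q / 2 * \<chi> (?t r) - \<epsilon> * of_nat q ^ 2 / 2 * (if ?t r = 0 then \<eta> r else 0) + \<epsilon> / 2 * \<eta> r"
      unfolding quad_gauss_sum sum_psi quad_char_tr_zero[OF l]
      using eps_cases by (auto simp: algebra_simps)
  qed simp
  also have "\<dots> = of_nat q / 2 * (\<Sum>r\<in>F-{0}. \<chi> (?t r))
      - \<epsilon> * of_nat q ^ 2 / 2 * (\<Sum>r\<in>F-{0}. if ?t r = 0 then \<eta> r else 0)"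
    by (simp only: sum.distrib sum_subtractf sum_distrib_left[symmetric] sum_sub_char_nonzero) simp
  finally show ?thesis .
qed

lemma twisted_sum_0_0:
  assumes "tr l = 0" "l \<noteq> 0"
  shows "twisted_sum l 0 0 = 0"
  using q_gt_1 by (simp add: twisted_sum_eq[OF assms] sum_sub_char_nonzero power_0_left)

lemma twisted_sum_0_left:
  assumes "tr l = 0" "l \<noteq> 0" "b \<noteq> 0"
  shows "twisted_sum l 0 b = of_nat q * (of_nat q - 1) / 2 * \<chi> b"
  using q_gt_1 assms
  by (simp add: twisted_sum_eq quad_char_power_q card_F_nonzero of_nat_diff)

lemma twisted_sum_0_right:
  assumes "tr l = 0" "l \<noteq> 0" "a \<noteq> 0"
  shows "twisted_sum l a 0 = - \<epsilon> * of_nat q * (of_nat q - 1) / 2 * \<chi> a"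
proof -
  have "(\<Sum>r\<in>F-{0}. \<chi> (a * l * r + 0 ^ q)) = (\<Sum>r\<in>F-{0}. - \<epsilon> * \<chi> a)"
    using q_gt_1 assms
    by (intro sum.cong) (auto simp: quad_char_mult quad_char_F quad_char_tr_zero power_0_left)
  moreover have "(\<Sum>r\<in>F-{0}. if a * l * r + 0 ^ q = 0 then \<eta> r else 0) = 0"
    using q_gt_1 assms by (intro sum.neutral) (auto simp: power_0_left)
  ultimately show ?thesis
    using q_gt_1 by (simp add: twisted_sum_eq[OF assms(1,2)] card_F_nonzero of_nat_diff)
qed

text \<open>Here \<open>a * l * r + b ^ q\<close> is \<open>a * l * (r + z)\<close> with
  \<open>z\<close> outside \<open>F\<close>. It never vanishes, and its \<chi> sum is that of a full
  line less the term at \<open>r = 0\<close>.\<close>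

lemma twisted_sum_generic:
  assumes l: "tr l = 0" "l \<noteq> 0" and ab: "tr (a * b) \<noteq> 0"
  shows "twisted_sum l a b = of_nat q / 2 * (\<epsilon> * \<chi> a - \<chi> b)"
proof -
  have nz: "a \<noteq> 0" "b \<noteq> 0"
    using ab by auto
  define z where "z = b ^ q / (a * l)"
  have z: "z \<notin> F"
  proof
    assume "z \<in> F"
    \<comment> \<open>The norm of \<open>b\<close> turns \<open>z \<in> F\<close> into
      \<open>a * b * l \<in> F\<close>; as \<open>l\<close> is negated by the map
      \<open>x ^ q\<close>, so is \<open>a * b\<close>.\<close>
    then have "inverse z * (b ^ (q + 1)) \<in> F"
      using F_mult norm_in_F by (simp del: power_Suc)
    also have "inverse z * (b ^ (q + 1)) = a * b * l"
      using nz l by (simp add: z_def field_simps)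
    finally have "(a * b) ^ q = - (a * b)"
      using l nz by (simp add: subfield_iff power_mult_distrib tr_eq_0_iff)
        (metis (no_types, lifting) mult_minus_left mult_right_cancel minus_mult_minus mult_minus_right)
    with ab show False
      by (simp add: tr_eq_0_iff)
  qed
  have t: "a * l * r + b ^ q = a * l * (r + z)" for r
    using nz l by (simp add: z_def field_simps)
  have "(\<Sum>r\<in>F-{0}. if a * l * r + b ^ q = 0 then \<eta> r else 0) = 0"
  proof (rule sum.neutral, intro ballI)
    fix r assume "r \<in> F - {0}"
    then have "r + z \<noteq> 0"
      using z by (auto simp: add_eq_0_iff)
    then show "(if a * l * r + b ^ q = 0 then \<eta> r else 0) = 0"
      unfolding t using nz l by simp
  qed
  moreover have "(\<Sum>r\<in>F-{0}. \<chi> (a * l * r + b ^ q)) = (\<Sum>r\<in>F. \<chi> (a * l * r + b ^ q)) - \<chi> (b ^ q)"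
    by (simp add: sum_diff1)
  moreover have "(\<Sum>r\<in>F. \<chi> (a * l * r + b ^ q)) = \<chi> a * \<chi> l * (\<Sum>r\<in>F. \<chi> (r + z))"
    unfolding t by (simp add: quad_char_mult sum_distrib_left)
  ultimately show ?thesis
    by (simp add: twisted_sum_eq[OF l] sum_quad_char_line[OF z] quad_char_power_q quad_char_tr_zero[OF l])
qed

text \<open>Now \<open>z\<close> lies in \<open>F\<close>, so \<chi>(r + z) is 1 except at
  \<open>r = - z\<close>, which also gives the only term of the \<eta> sum. The norm of
  \<open>a * l\<close> relates \<eta>(z) to \<eta>(a b l).\<close>

lemma twisted_sum_degenerate:
  assumes l: "tr l = 0" "l \<noteq> 0" and ab: "tr (a * b) = 0" "a \<noteq> 0" "b \<noteq> 0"
  shows "twisted_sum l a b = of_nat q / 2 * (\<epsilon> * \<chi> a * (2 - of_nat q + of_nat q * \<eta> (a * b * l)))"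
proof -
  define z where "z = b ^ q / (a * l)"
  have abl: "a * b * l \<in> F"
    using ab l by (simp add: subfield_iff tr_eq_0_iff power_mult_distrib)
  have norm: "(a * l) ^ (q + 1) \<in> F"
    by (rule norm_in_F)
  have "z = a * b * l / (a * l) ^ (q + 1)"
  proof -
    have "b ^ q * (a * l) ^ q = (a * b) ^ q * l ^ q"
      by (simp add: power_mult_distrib mult_ac)
    also have "\<dots> = a * b * l"
      using ab l by (simp add: tr_eq_0_iff)
    finally have "b ^ q * (a * l) ^ q = a * b * l" .
    moreover have "z = b ^ q * (a * l) ^ q / (a * l) ^ (q + 1)"
      using ab l by (simp add: z_def)
    ultimately show ?thesis by simp
  qed
  moreover have "\<eta> (a * b * l / (a * l) ^ (q + 1)) = \<eta> (a * b * l) * (- \<epsilon> * \<chi> a)"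
    unfolding sub_char_divide[OF abl norm] quad_char_norm[symmetric] quad_char_mult quad_char_tr_zero[OF l]
    by (simp only: mult.commute)
  ultimately have z: "z \<in> F" "\<eta> z = \<eta> (a * b * l) * (- \<epsilon> * \<chi> a)"
    using F_divide[OF abl norm] by simp_all
  have z0: "z \<noteq> 0"
    using ab l by (simp add: z_def)
  have t: "a * l * r + b ^ q = a * l * (r + z)" for r
    using ab l by (simp add: z_def field_simps)
  have "(\<Sum>r\<in>F-{0}. if a * l * r + b ^ q = 0 then \<eta> r else 0) = (\<Sum>r\<in>F-{0}. if r = - z then \<eta> r else 0)"
    unfolding t using ab l by (intro sum.cong refl) (simp add: add_eq_0_iff2)
  also have "\<dots> = \<epsilon> * \<eta> z"
    using z z0 by (subst sum.delta) (auto simp: sub_char_uminus)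
  finally have 1: "(\<Sum>r\<in>F-{0}. if a * l * r + b ^ q = 0 then \<eta> r else 0) = - (\<chi> a * \<eta> (a * b * l))"
    unfolding z(2) by (simp add: mult_ac)
  have "(\<Sum>r\<in>F-{0}. \<chi> (a * l * r + b ^ q)) = \<chi> a * - \<epsilon> * (\<Sum>r\<in>F-{0}. \<chi> (r + z))"
    unfolding t quad_char_mult quad_char_tr_zero[OF l] by (simp add: sum_distrib_left)
  also have "(\<Sum>r\<in>F-{0}. \<chi> (r + z)) = (\<Sum>r\<in>F. \<chi> (r + z)) - \<chi> z"
    by (simp add: sum_diff1)
  also have "(\<Sum>r\<in>F. \<chi> (r + z)) = (\<Sum>r\<in>F. \<chi> r)"
    by (rule sum.reindex_bij_witness[of _ "\<lambda>r. r - z" "\<lambda>r. r + z"]) (auto intro: F_add F_diff z)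
  also have "\<dots> = (\<Sum>r\<in>F-{0}. \<chi> r)"
    by (simp add: sum_diff1)
  also have "\<dots> = of_nat q - 1"
    using q_gt_1 by (simp add: quad_char_F card_F_nonzero of_nat_diff)
  also have "\<chi> z = 1"
    using z z0 by (intro quad_char_F)
  finally have 2: "(\<Sum>r\<in>F-{0}. \<chi> (a * l * r + b ^ q)) = - \<epsilon> * \<chi> a * (of_nat q - 2)"
    by simp
  show ?thesis
    unfolding twisted_sum_eq[OF l] 1 2 by (simp add: field_simps power2_eq_square)
qed

end

section \<open>The two character values\<close>

context additive_character
begin

definition pair_sum :: "('a \<times> 'a) set \<Rightarrow> 'a \<Rightarrow> 'a \<Rightarrow> complex"
  where "pair_sum S a b = (\<Sum>(x, y)\<in>S. \<psi> (a * x + b * y))"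

lemma pair_sum_Un: "S \<inter> T = {} \<Longrightarrow> pair_sum (S \<union> T) a b = pair_sum S a b + pair_sum T a b"
  unfolding pair_sum_def by (rule sum.union_disjoint) auto

lemma pair_sum_0_0: "pair_sum S 0 0 = of_nat (card S)"
  by (simp add: pair_sum_def)

lemma pair_sum_indicator:
  "pair_sum S a b = (\<Sum>U\<in>UNIV. \<Sum>V\<in>UNIV. of_bool ((U, V) \<in> S) * \<psi> (a * U + b * V))"
proof -
  have "pair_sum S a b = (\<Sum>p\<in>UNIV. of_bool (p \<in> S) * (case p of (x, y) \<Rightarrow> \<psi> (a * x + b * y)))"
    unfolding pair_sum_def by (intro sum.mono_neutral_cong_left) auto
  also have "\<dots> = (\<Sum>(U, V)\<in>UNIV \<times> UNIV. of_bool ((U, V) \<in> S) * \<psi> (a * U + b * V))"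
    by (simp add: split_beta)
  finally show ?thesis
    by (simp only: sum.cartesian_product)
qed

lemma sum_psi_nonzero:
  "(\<Sum>x\<in>UNIV. of_bool (x \<noteq> 0) * \<psi> (a * x)) = (if a = 0 then of_nat q ^ 2 else 0) - 1"
proof -
  have "(\<Sum>x\<in>UNIV. of_bool (x \<noteq> 0) * \<psi> (a * x)) = (\<Sum>x\<in>UNIV-{0}. \<psi> (a * x))"
    by (intro sum.mono_neutral_cong_right) auto
  then show ?thesis
    using sum_psi[of a] by (simp add: sum_diff1)
qed

text \<open>The indicator of the class is half of
  \<open>of_bool (y \<noteq> 0) + s * \<chi> y\<close>.\<close>

lemma sum_psi_class:
  assumes "s = 1 \<or> s = - 1"
  shows "(\<Sum>y\<in>{y. \<chi> y = s}. \<psi> (b * y))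
    = ((if b = 0 then of_nat q ^ 2 else 0) - 1 - s * \<epsilon> * of_nat q * \<chi> b) / 2"
proof -
  have "(\<Sum>y\<in>{y. \<chi> y = s}. \<psi> (b * y))
      = (\<Sum>y\<in>UNIV. (of_bool (y \<noteq> 0) * \<psi> (b * y) + s * (\<chi> y * \<psi> (b * y))) / 2)"
  proof (intro sum.mono_neutral_cong_left ballI)
    fix y assume "y \<in> {y. \<chi> y = s}"
    with assms show "\<psi> (b * y) = (of_bool (y \<noteq> 0) * \<psi> (b * y) + s * (\<chi> y * \<psi> (b * y))) / 2"
      by (cases "y = 0") auto
  next
    fix y assume "y \<in> UNIV - {y. \<chi> y = s}"
    with assms quad_char_values[of y]
    show "(of_bool (y \<noteq> 0) * \<psi> (b * y) + s * (\<chi> y * \<psi> (b * y))) / 2 = 0"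
      by (cases "y = 0") auto
  qed auto
  also have "\<dots> = ((\<Sum>y\<in>UNIV. of_bool (y \<noteq> 0) * \<psi> (b * y)) + s * (\<Sum>y\<in>UNIV. \<chi> y * \<psi> (b * y))) / 2"
    by (simp only: sum_divide_distrib[symmetric] sum.distrib sum_distrib_left[symmetric])
  finally show ?thesis
    by (simp only: sum_psi_nonzero quad_gauss_sum) (simp add: algebra_simps)
qed

text \<open>The union of \<open>D2\<close> and \<open>D3\<close> described by the coordinates alone,
  once \<alpha> and \<beta> are the unions of classes given by \<open>A\<close> and
  \<open>B\<close>.\<close>

definition mixed_set :: "'a set \<Rightarrow> 'a set \<Rightarrow> ('a \<times> 'a) set"
  where "mixed_set \<alpha> \<beta> =
    {(U, V). U \<noteq> 0 \<and> V \<noteq> 0 \<and> (\<chi> U = 1 \<and> U * V \<in> \<alpha> \<or> \<chi> U = - 1 \<and> U * V \<in> \<beta>)}"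

end

text \<open>\<open>l\<^sub>1\<close> and \<open>l\<^sub>2\<close> represent the square classes on
  which one of \<open>tr z\<close>, \<open>tr (\<theta> * z)\<close> vanishes and the other is a
  nonzero square; \<open>d\<^sub>1\<close> and \<open>d\<^sub>2\<close> are the differences of the
  two indicators there.\<close>

locale type_Q_configuration = additive_character q \<omega> \<psi>
  for q :: nat and \<omega> :: "'a::finite_field" and \<psi> :: "'a \<Rightarrow> complex" +
  fixes \<theta> l\<^sub>1 l\<^sub>2 :: 'a and d\<^sub>1 d\<^sub>2 :: complex and \<alpha> \<beta> :: "'a set"
  assumes theta: "\<chi> \<theta> = - 1"
    and l1: "l\<^sub>1 \<noteq> 0" "tr l\<^sub>1 = 0" "\<eta> (tr (\<theta> * l\<^sub>1)) = 1"
    and l2: "l\<^sub>2 \<noteq> 0" "tr (\<theta> * l\<^sub>2) = 0" "\<eta> (tr l\<^sub>2) = 1"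
    and ind_sum: "\<And>z. z \<noteq> 0 \<Longrightarrow>
      of_bool (z \<in> \<alpha>) + of_bool (z \<in> \<beta>) = (1 + \<eta> (tr z)) * (1 + \<eta> (tr (\<theta> * z))) / 2"
    and ind_diff: "\<And>z. z \<noteq> 0 \<Longrightarrow>
      of_bool (z \<in> \<alpha>) - of_bool (z \<in> \<beta>)
        = d\<^sub>1 * of_bool (z / l\<^sub>1 \<in> nonzero_squares q) + d\<^sub>2 * of_bool (z / l\<^sub>2 \<in> nonzero_squares q)"
begin

lemma theta_nonzero: "\<theta> \<noteq> 0"
  using theta by auto

text \<open>It is \<open>\<theta> * l\<^sub>2\<close>, not \<open>l\<^sub>2\<close>, that has trace
  zero; rescaling \<open>V\<close> by \<theta> passes to this representative and divides
  \<open>b\<close> by \<theta>.\<close>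

lemma twisted_sum_scaled:
  "(\<Sum>U\<in>UNIV. \<Sum>V\<in>UNIV. \<chi> U * of_bool (U * V / l\<^sub>2 \<in> nonzero_squares q) * \<psi> (a * U + b * V))
    = twisted_sum (\<theta> * l\<^sub>2) a (b / \<theta>)"
  unfolding twisted_sum_def
proof (rule sum.cong[OF refl])
  fix U
  have "(\<Sum>V\<in>UNIV. \<chi> U * of_bool (U * V / (\<theta> * l\<^sub>2) \<in> nonzero_squares q) * \<psi> (a * U + b / \<theta> * V))
      = (\<Sum>V\<in>UNIV. \<chi> U * of_bool (U * (\<theta> * V) / (\<theta> * l\<^sub>2) \<in> nonzero_squares q) * \<psi> (a * U + b / \<theta> * (\<theta> * V)))"
    using theta_nonzero by (rule sum_UNIV_scale[symmetric])
  then show "(\<Sum>V\<in>UNIV. \<chi> U * of_bool (U * V / l\<^sub>2 \<in> nonzero_squares q) * \<psi> (a * U + b * V))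
      = (\<Sum>V\<in>UNIV. \<chi> U * of_bool (U * V / (\<theta> * l\<^sub>2) \<in> nonzero_squares q) * \<psi> (a * U + b / \<theta> * V))"
    using theta_nonzero by (simp add: mult.left_commute[of _ \<theta>])
qed

text \<open>The indicator is half of the sum of the two class indicators plus \<chi>(U) times half
  of their difference; expanded, its six summands are transformed separately.\<close>

lemma pair_sum_mixed:
  "pair_sum (mixed_set \<alpha> \<beta>) a b =
    (((if a = 0 then of_nat q ^ 2 else 0) - 1) * ((if b = 0 then of_nat q ^ 2 else 0) - 1)
      + of_nat q ^ 2 * (\<epsilon> * \<eta> (tr (a * b)) + \<epsilon> * \<eta> (tr (a * b / \<theta>))
          - \<eta> (tr (a * b)) * \<eta> (tr (a * b / \<theta>)))) / 4
    + (d\<^sub>1 * twisted_sum l\<^sub>1 a b + d\<^sub>2 * twisted_sum (\<theta> * l\<^sub>2) a (b / \<theta>)) / 2"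
proof -
  let ?k = "\<lambda>U V. \<psi> (a * U + b * V)"
  let ?c = "\<lambda>l z. of_bool (z / l \<in> nonzero_squares q) :: complex"
  have "of_bool ((U, V) \<in> mixed_set \<alpha> \<beta>) * ?k U V =
      (1 / 4) * ((of_bool (U \<noteq> 0) * \<psi> (a * U)) * (of_bool (V \<noteq> 0) * \<psi> (b * V)))
      + (1 / 4) * (\<eta> (tr (1 * (U * V))) * ?k U V)
      + (1 / 4) * (\<eta> (tr (\<theta> * (U * V))) * ?k U V)
      + (1 / 4) * (\<eta> (tr (U * V)) * \<eta> (tr (\<theta> * (U * V))) * ?k U V)
      + (d\<^sub>1 / 2) * (\<chi> U * ?c l\<^sub>1 (U * V) * ?k U V)
      + (d\<^sub>2 / 2) * (\<chi> U * ?c l\<^sub>2 (U * V) * ?k U V)" for U V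
  proof (cases "U = 0 \<or> V = 0")
    \<comment> \<open>On the axes every summand is 0, since \<eta>(0) = 0 and 0 is not a nonzero
      square.\<close>
    case True
    then show ?thesis
      using nonzero_squares_subset by (auto simp: mixed_set_def)
  next
    case False
    then have nz: "U * V \<noteq> 0" by simp
    have "of_bool ((U, V) \<in> mixed_set \<alpha> \<beta>) =
        (of_bool (U * V \<in> \<alpha>) + of_bool (U * V \<in> \<beta>)) / 2
        + \<chi> U * (of_bool (U * V \<in> \<alpha>) - of_bool (U * V \<in> \<beta>)) / 2"
      using False quad_char_values[of U] by (auto simp: mixed_set_def)
    also have "\<dots> = (1 + \<eta> (tr (U * V))) * (1 + \<eta> (tr (\<theta> * (U * V)))) / 2 / 2
        + \<chi> U * (d\<^sub>1 * ?c l\<^sub>1 (U * V) + d\<^sub>2 * ?c l\<^sub>2 (U * V)) / 2"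
      by (simp only: ind_sum[OF nz] ind_diff[OF nz])
    finally have e: "of_bool ((U, V) \<in> mixed_set \<alpha> \<beta>) = \<dots>" .
    have k: "(of_bool (U \<noteq> 0) * \<psi> (a * U)) * (of_bool (V \<noteq> 0) * \<psi> (b * V)) = ?k U V"
      using False by (simp add: psi_add)
    show ?thesis
      unfolding e k by (simp add: field_simps)
  qed
  then have "pair_sum (mixed_set \<alpha> \<beta>) a b =
      (1 / 4) * ((\<Sum>U\<in>UNIV. of_bool (U \<noteq> 0) * \<psi> (a * U)) * (\<Sum>V\<in>UNIV. of_bool (V \<noteq> 0) * \<psi> (b * V)))
      + (1 / 4) * (\<Sum>U\<in>UNIV. \<Sum>V\<in>UNIV. \<eta> (tr (1 * (U * V))) * ?k U V)
      + (1 / 4) * (\<Sum>U\<in>UNIV. \<Sum>V\<in>UNIV. \<eta> (tr (\<theta> * (U * V))) * ?k U V)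
      + (1 / 4) * (\<Sum>U\<in>UNIV. \<Sum>V\<in>UNIV. \<eta> (tr (U * V)) * \<eta> (tr (\<theta> * (U * V))) * ?k U V)
      + (d\<^sub>1 / 2) * (\<Sum>U\<in>UNIV. \<Sum>V\<in>UNIV. \<chi> U * ?c l\<^sub>1 (U * V) * ?k U V)
      + (d\<^sub>2 / 2) * (\<Sum>U\<in>UNIV. \<Sum>V\<in>UNIV. \<chi> U * ?c l\<^sub>2 (U * V) * ?k U V)"
    unfolding pair_sum_indicator sum_product
    by (simp only: sum.distrib sum_distrib_left[symmetric])
  then show ?thesis
    unfolding sum_psi_nonzero transform_eta[OF one_neq_zero] transform_eta[OF theta_nonzero]
      transform_eta_eta[OF theta] twisted_sum_scaled twisted_sum_def[symmetric]
    by (rule trans) (simp add: field_simps split del: if_split)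
qed

lemma sub_char_tr_ratio:
  assumes "\<mu> \<in> F"
  shows "\<eta> (tr (\<mu> / x)) = \<eta> \<mu> * \<chi> x * \<eta> (tr x)"
proof -
  have "tr (\<mu> * x ^ q) = \<mu> * tr x"
    using assms by (simp add: tr_scale tr_power_q)
  then show ?thesis
    using assms by (simp add: sub_char_tr_divide sub_char_mult)
qed

text \<open>Both \<open>a * b\<close> and \<open>l\<^sub>1\<close> have trace zero, so their product
  \<mu> is in \<open>F\<close>. Writing \<open>a * b / \<theta>\<close> as \<mu> over
  \<open>\<theta> * l\<^sub>1\<close> expresses \<eta>(\<mu>) through the other trace. The second
  claim is \<open>\<chi> (a * b) = - \<epsilon>\<close>.\<close>

lemma twisted_sum_l1_degenerate:
  assumes "tr (a * b) = 0" "a \<noteq> 0" "b \<noteq> 0"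
  shows "twisted_sum l\<^sub>1 a b
      = of_nat q / 2 * (\<epsilon> * \<chi> a * (2 - of_nat q + of_nat q * (\<epsilon> * \<eta> (tr (a * b / \<theta>)))))"
    and "\<chi> b = - \<epsilon> * \<chi> a"
proof -
  let ?\<mu> = "a * b * l\<^sub>1"
  have "?\<mu> \<in> F"
    using assms l1 by (simp add: subfield_iff tr_eq_0_iff power_mult_distrib)
  then have "\<eta> (tr (?\<mu> / (\<theta> * l\<^sub>1))) = \<eta> ?\<mu> * \<chi> (\<theta> * l\<^sub>1) * \<eta> (tr (\<theta> * l\<^sub>1))"
    by (rule sub_char_tr_ratio)
  moreover have "?\<mu> / (\<theta> * l\<^sub>1) = a * b / \<theta>"
    using l1 by simp
  moreover have "\<chi> (\<theta> * l\<^sub>1) = \<epsilon>"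
    using l1 by (simp add: quad_char_mult theta quad_char_tr_zero)
  ultimately have "\<eta> (tr (a * b / \<theta>)) = \<eta> ?\<mu> * \<epsilon>"
    using l1 by simp
  then have "\<eta> ?\<mu> = \<epsilon> * \<eta> (tr (a * b / \<theta>))"
    by simp
  then show "twisted_sum l\<^sub>1 a b
      = of_nat q / 2 * (\<epsilon> * \<chi> a * (2 - of_nat q + of_nat q * (\<epsilon> * \<eta> (tr (a * b / \<theta>)))))"
    using twisted_sum_degenerate[OF l1(2,1) assms] by simp
  have "\<chi> a * \<chi> b = - \<epsilon>"
    using assms quad_char_tr_zero[of "a * b"] by (simp add: quad_char_mult)
  then have "\<chi> a * \<chi> a * \<chi> b = - \<epsilon> * \<chi> a"
    by (simp add: mult.assoc)
  then show "\<chi> b = - \<epsilon> * \<chi> a"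
    by (simp only: quad_char_square[OF assms(2)] mult_1)
qed

text \<open>The previous argument with \<open>a * b / \<theta>\<close> and
  \<open>\<theta> * l\<^sub>2\<close> as the trace-zero elements; the factor \<chi>(\<theta>) = -1
  changes the sign in the second claim.\<close>

lemma twisted_sum_l2_degenerate:
  assumes "tr (a * b / \<theta>) = 0" "a \<noteq> 0" "b \<noteq> 0"
  shows "twisted_sum (\<theta> * l\<^sub>2) a (b / \<theta>)
      = of_nat q / 2 * (\<epsilon> * \<chi> a * (2 - of_nat q + of_nat q * (\<epsilon> * \<eta> (tr (a * b)))))"
    and "\<chi> b = \<epsilon> * \<chi> a"
proof -
  let ?\<mu> = "a * b * l\<^sub>2"
  have \<theta>l: "\<theta> * l\<^sub>2 \<noteq> 0"
    using l2 theta_nonzero by simp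
  have e: "a * (b / \<theta>) * (\<theta> * l\<^sub>2) = ?\<mu>"
    using theta_nonzero by simp
  have "(a * b / \<theta>) * (\<theta> * l\<^sub>2) \<in> F"
    using assms(1) l2(2) by (simp add: subfield_iff tr_eq_0_iff power_mult_distrib del: times_divide_eq_left)
  then have "?\<mu> \<in> F"
    using e by simp
  then have "\<eta> (tr (?\<mu> / l\<^sub>2)) = \<eta> ?\<mu> * \<chi> l\<^sub>2 * \<eta> (tr l\<^sub>2)"
    by (rule sub_char_tr_ratio)
  moreover have "?\<mu> / l\<^sub>2 = a * b"
    using l2 by simp
  moreover have "\<chi> l\<^sub>2 = \<epsilon>"
    using quad_char_tr_zero[OF l2(2) \<theta>l] by (simp add: quad_char_mult theta)
  ultimately have "\<eta> (tr (a * b)) = \<eta> ?\<mu> * \<epsilon>"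
    using l2 by simp
  then have "\<eta> ?\<mu> = \<epsilon> * \<eta> (tr (a * b))"
    by simp
  then show "twisted_sum (\<theta> * l\<^sub>2) a (b / \<theta>)
      = of_nat q / 2 * (\<epsilon> * \<chi> a * (2 - of_nat q + of_nat q * (\<epsilon> * \<eta> (tr (a * b)))))"
    using twisted_sum_degenerate[OF l2(2) \<theta>l, of a "b / \<theta>", unfolded e] assms theta_nonzero
    by simp
  have "\<chi> a * \<chi> b * - 1 = - \<epsilon>"
    using assms theta_nonzero quad_char_tr_zero[of "a * b / \<theta>"]
    by (simp add: quad_char_mult quad_char_divide theta)
  then have "\<chi> a * \<chi> a * \<chi> b = \<epsilon> * \<chi> a"
    by (simp add: mult.assoc)
  then show "\<chi> b = \<epsilon> * \<chi> a"
    by (simp only: quad_char_square[OF assms(2)] mult_1)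
qed

lemma twisted_sum_l2_generic:
  assumes "tr (a * b / \<theta>) \<noteq> 0"
  shows "twisted_sum (\<theta> * l\<^sub>2) a (b / \<theta>) = of_nat q / 2 * (\<epsilon> * \<chi> a + \<chi> b)"
  using assms twisted_sum_generic[of "\<theta> * l\<^sub>2" a "b / \<theta>"] l2 theta_nonzero
  by (simp add: quad_char_divide theta)

text \<open>Otherwise \<theta>, a quotient of two trace-zero elements, would lie in
  \<open>F\<close>.\<close>

lemma trace_not_both_zero:
  assumes "a * b \<noteq> 0" "tr (a * b) = 0"
  shows "tr (a * b / \<theta>) \<noteq> 0"
proof
  assume "tr (a * b / \<theta>) = 0"
  then have "a * b / (a * b / \<theta>) \<in> F"
    using assms(2) by (intro tr_zero_ratio)
  then have "\<theta> \<in> F"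
    using assms(1) theta_nonzero by simp
  then show False
    using quad_nonresidue_notin_F[OF theta] by simp
qed

abbreviation "two_values \<equiv> {(of_nat q ^ 2 - 1) / 4, (- 3 * of_nat q ^ 2 - 1) / 4 :: complex}"

text \<open>In the generic case the twisted sums contribute - q \<chi>(b) / 2, cancelled by the
  axis. With f1, f2 equal to \<epsilon> times the two \<eta> values, the quadratic term is q^2 (f1 +
  f2 - f1 f2) / 4, whose bracket is 1 or -3. If one trace vanishes, a degenerate twisted sum
  supplies the missing multiple of q^2.\<close>

lemma char_values_D0:
  assumes ab: "(a, b) \<noteq> (0, 0)" and d: "d\<^sub>1 = 1" "d\<^sub>2 = - 1"
  shows "pair_sum (mixed_set \<alpha> \<beta>) a b + (\<Sum>y\<in>{y. \<chi> y = - \<epsilon>}. \<psi> (b * y)) \<in> two_values"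
proof -
  have s: "- \<epsilon> = 1 \<or> - \<epsilon> = - 1"
    using eps_cases by auto
  have \<theta>l: "\<theta> * l\<^sub>2 \<noteq> 0"
    using l2 theta_nonzero by simp
  note T = pair_sum_mixed[of a b, unfolded d] sum_psi_class[OF s]
  consider (a) "a = 0" "b \<noteq> 0" | (b) "b = 0" "a \<noteq> 0"
    | (gen) "a \<noteq> 0" "b \<noteq> 0" "tr (a * b) \<noteq> 0" "tr (a * b / \<theta>) \<noteq> 0"
    | (z1) "a \<noteq> 0" "b \<noteq> 0" "tr (a * b) = 0" "tr (a * b / \<theta>) \<noteq> 0"
    | (z2) "a \<noteq> 0" "b \<noteq> 0" "tr (a * b) \<noteq> 0" "tr (a * b / \<theta>) = 0"
    using ab trace_not_both_zero[of a b] by auto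
  then show ?thesis
  proof cases
    case a
    have t: "twisted_sum (\<theta> * l\<^sub>2) 0 (b / \<theta>) = - (of_nat q * (of_nat q - 1) / 2 * \<chi> b)"
      using a theta_nonzero by (simp add: twisted_sum_0_left[OF l2(2) \<theta>l] quad_char_divide theta)
    then show ?thesis
      using a(2) quad_char_values[of b]
      unfolding T unfolding a(1) t twisted_sum_0_left[OF l1(2,1) a(2)]
      by (auto simp: field_simps power2_eq_square)
  next
    case b
    then show ?thesis
      unfolding T
      by (auto simp: twisted_sum_0_right[OF l1(2,1)] twisted_sum_0_right[OF l2(2) \<theta>l]
          field_simps power2_eq_square)
  next
    case gen
    then show ?thesis
      using sub_char_values[OF gen(3)] sub_char_values[OF gen(4)] eps_cases
      unfolding T twisted_sum_generic[OF l1(2,1) gen(3)] twisted_sum_l2_generic[OF gen(4)]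
      by (elim disjE) (simp_all add: field_simps power2_eq_square)
  next
    case z1
    then show ?thesis
      using sub_char_values[OF z1(4)] eps_cases quad_char_values[OF z1(1)]
      unfolding T twisted_sum_l1_degenerate[OF z1(3,1,2)] twisted_sum_l2_generic[OF z1(4)]
      by (elim disjE) (simp_all add: field_simps power2_eq_square)
  next
    case z2
    then show ?thesis
      using sub_char_values[OF z2(3)] eps_cases quad_char_values[OF z2(1)]
      unfolding T twisted_sum_l2_degenerate[OF z2(4,1,2)] twisted_sum_generic[OF l1(2,1) z2(3)]
      by (elim disjE) (simp_all add: field_simps power2_eq_square)
  qed
qed

text \<open>With equal signs the generic twisted sums add up to a multiple of \<chi>(a) instead of
  \<chi>(b), so the other axis cancels them.\<close>

lemma char_values_D1:
  assumes ab: "(a, b) \<noteq> (0, 0)" and d: "d\<^sub>1 = 1" "d\<^sub>2 = 1"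
  shows "pair_sum (mixed_set \<alpha> \<beta>) a b + (\<Sum>y\<in>{y. \<chi> y = 1}. \<psi> (a * y)) \<in> two_values"
proof -
  have s: "(1 :: complex) = 1 \<or> (1 :: complex) = - 1"
    by simp
  have \<theta>l: "\<theta> * l\<^sub>2 \<noteq> 0"
    using l2 theta_nonzero by simp
  note T = pair_sum_mixed[of a b, unfolded d] sum_psi_class[OF s]
  consider (a) "a = 0" "b \<noteq> 0" | (b) "b = 0" "a \<noteq> 0"
    | (gen) "a \<noteq> 0" "b \<noteq> 0" "tr (a * b) \<noteq> 0" "tr (a * b / \<theta>) \<noteq> 0"
    | (z1) "a \<noteq> 0" "b \<noteq> 0" "tr (a * b) = 0" "tr (a * b / \<theta>) \<noteq> 0"
    | (z2) "a \<noteq> 0" "b \<noteq> 0" "tr (a * b) \<noteq> 0" "tr (a * b / \<theta>) = 0"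
    using ab trace_not_both_zero[of a b] by auto
  then show ?thesis
  proof cases
    case a
    have t: "twisted_sum (\<theta> * l\<^sub>2) 0 (b / \<theta>) = - (of_nat q * (of_nat q - 1) / 2 * \<chi> b)"
      using a theta_nonzero by (simp add: twisted_sum_0_left[OF l2(2) \<theta>l] quad_char_divide theta)
    then show ?thesis
      using a(2) unfolding T unfolding a(1) t twisted_sum_0_left[OF l1(2,1) a(2)]
      by (auto simp: field_simps power2_eq_square)
  next
    case b
    then show ?thesis
      using quad_char_values[OF b(2)] eps_cases unfolding T
      by (auto simp: twisted_sum_0_right[OF l1(2,1)] twisted_sum_0_right[OF l2(2) \<theta>l]
          field_simps power2_eq_square)
  next
    case gen
    then show ?thesis
      using sub_char_values[OF gen(3)] sub_char_values[OF gen(4)] eps_cases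
      unfolding T twisted_sum_generic[OF l1(2,1) gen(3)] twisted_sum_l2_generic[OF gen(4)]
      by (elim disjE) (simp_all add: field_simps power2_eq_square)
  next
    case z1
    then show ?thesis
      using sub_char_values[OF z1(4)] eps_cases quad_char_values[OF z1(1)]
      unfolding T twisted_sum_l1_degenerate[OF z1(3,1,2)] twisted_sum_l2_generic[OF z1(4)]
      by (elim disjE) (simp_all add: field_simps power2_eq_square)
  next
    case z2
    then show ?thesis
      using sub_char_values[OF z2(3)] eps_cases quad_char_values[OF z2(1)]
      unfolding T twisted_sum_l2_degenerate[OF z2(4,1,2)] twisted_sum_generic[OF l1(2,1) z2(3)]
      by (elim disjE) (simp_all add: field_simps power2_eq_square)
  qed
qed

lemma pair_sum_mixed_0_0: "pair_sum (mixed_set \<alpha> \<beta>) 0 0 = (of_nat q ^ 2 - 1)\<^sup>2 / 4"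
  using l1 l2 theta_nonzero
  by (simp add: pair_sum_mixed twisted_sum_0_0 power2_eq_square)

end

section \<open>The canonical additive character\<close>

text \<open>Translation by 1 shows that the number of elements is zero in the field, so the prime
  characteristic divides \<open>p ^ n\<close>.\<close>

lemma CHAR_eq_prime:
  assumes "prime p" "CARD('a::finite_field) = p ^ n"
  shows "CHAR('a) = p"
proof -
  have "(\<Sum>x\<in>UNIV. x) = (\<Sum>x\<in>UNIV. x + (1 :: 'a))"
    by (rule sum.reindex_bij_witness[of _ "\<lambda>x. x + 1" "\<lambda>x. x - 1"]) auto
  then have "of_nat CARD('a) = (0 :: 'a)"
    by (simp add: sum.distrib)
  then have "CHAR('a) dvd p ^ n"
    by (simp only: of_nat_eq_0_iff_char_dvd assms(2))
  then have "CHAR('a) dvd p"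
    using CHAR_prime[where ?'a = 'a] by (rule prime_dvd_power[rotated])
  then show ?thesis
    using assms(1) CHAR_prime[where ?'a = 'a] by (simp add: primes_dvd_imp_eq)
qed

text \<open>\<open>field_type\<close> ties the locale to the field, which does not occur in the
  types of the other parameters.\<close>

locale canonical_character =
  fixes p n :: nat and \<zeta> :: complex and field_type :: "'a::finite_field itself"
  assumes prime_p: "prime p" and card_p: "CARD('a) = p ^ n" and n_pos: "n > 0"
    and root: "primitive_root_of_unity p \<zeta>"
begin

lemma CHAR_p: "CHAR('a) = p"
  using prime_p card_p by (rule CHAR_eq_prime)

lemma frobenius: "((x :: 'a) + y) ^ p ^ k = x ^ p ^ k + y ^ p ^ k"
  by (rule freshmans_dream') (simp_all add: CHAR_p prime_p)

lemma p_gt_1: "p > 1"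
  using prime_p by (rule prime_gt_1_nat)

lemma of_nat_power_p: "(of_nat k :: 'a) ^ p = of_nat k"
proof (induction k)
  case 0
  show ?case
    using p_gt_1 by simp
next
  case (Suc k)
  then show ?case
    using frobenius[of 1 "of_nat k" 1] by simp
qed

text \<open>The \<open>p\<close> distinct elements \<open>of_nat k\<close> are roots of
  \<open>x ^ p - x\<close>, which has at most \<open>p\<close> roots.\<close>

lemma prime_field_eq: "{x :: 'a. x ^ p = x} = of_nat ` {..<p}"
proof (rule card_seteq[symmetric])
  let ?P = "monom 1 p - monom 1 1 :: 'a poly"
  have "coeff ?P p = 1"
    using p_gt_1 by simp
  then have nz: "?P \<noteq> 0"
    by (metis coeff_0 zero_neq_one)
  have "{x :: 'a. x ^ p = x} = {x. poly ?P x = 0}"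
    by (simp add: poly_monom)
  also have "card \<dots> \<le> degree ?P"
    using nz by (rule card_poly_roots_bound)
  also have "\<dots> \<le> p"
    using p_gt_1 by (intro degree_diff_le) (auto intro: order.trans[OF degree_monom_le])
  also have "p = card ((of_nat :: nat \<Rightarrow> 'a) ` {..<p})"
    by (subst card_image) (auto simp: inj_on_def of_nat_eq_iff_cong_CHAR CHAR_p cong_def)
  finally show "card {x :: 'a. x ^ p = x} \<le> card ((of_nat :: nat \<Rightarrow> 'a) ` {..<p})" .
qed (auto simp: of_nat_power_p)

lemma abs_trace_add: "abs_trace p n (x + y) = abs_trace p n x + abs_trace p n (y :: 'a)"
  by (simp add: abs_trace_def frobenius sum.distrib)

text \<open>The power map permutes the summands cyclically, since
  \<open>x ^ p ^ n = x\<close>.\<close>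

lemma abs_trace_power_p: "abs_trace p n ((x :: 'a) ^ p) = abs_trace p n x"
proof -
  have "x ^ p ^ n = x"
    using finite_field_power_card_eq_same[of x] by (simp add: card_p)
  then have "(\<Sum>k<Suc n. x ^ p ^ k) = abs_trace p n x + x"
    by (simp add: abs_trace_def)
  moreover have "(\<Sum>k<Suc n. x ^ p ^ k) = x + (\<Sum>k<n. x ^ p ^ Suc k)"
    by (simp only: sum.lessThan_Suc_shift) simp
  moreover have "abs_trace p n (x ^ p) = (\<Sum>k<n. x ^ p ^ Suc k)"
    by (simp add: abs_trace_def flip: power_mult)
  ultimately show ?thesis
    by simp
qed

lemma abs_trace_power_p_power: "abs_trace p n ((x :: 'a) ^ p ^ k) = abs_trace p n x"
proof (induction k)
  case (Suc k)
  have "x ^ p ^ Suc k = (x ^ p ^ k) ^ p"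
    by (simp only: power_mult[symmetric] power_Suc mult.commute)
  then show ?case
    by (simp only: abs_trace_power_p Suc.IH)
qed simp

text \<open>The trace is fixed by \<open>x ^ p\<close>, hence lies in the prime field; this is the
  existence half of the description in \<open>canonical_char\<close>.\<close>

lemma abs_trace_in_prime_field: obtains k where "k < p" "of_nat k = abs_trace p n (x :: 'a)"
proof -
  have "abs_trace p n x ^ p = abs_trace p n (x ^ p)"
  proof -
    have "abs_trace p n x ^ p = (\<Sum>k<n. (x ^ p ^ k) ^ p)"
      unfolding abs_trace_def by (rule freshmans_dream_sum) (simp_all add: CHAR_p prime_p)
    moreover have "(x ^ p ^ k) ^ p = (x ^ p) ^ p ^ k" for k
      by (simp only: power_mult[symmetric] mult.commute)
    ultimately show ?thesis
      by (simp only: abs_trace_def)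
  qed
  then have "abs_trace p n x \<in> {x. x ^ p = x}"
    by (simp add: abs_trace_power_p)
  then have "abs_trace p n x \<in> of_nat ` {..<p}"
    by (simp only: prime_field_eq)
  then show thesis
    using that by auto
qed

lemma root_power_mod: "\<zeta> ^ (k mod p) = \<zeta> ^ k"
proof -
  have "\<zeta> ^ k = \<zeta> ^ (k mod p + p * (k div p))"
    by simp
  also have "\<dots> = \<zeta> ^ (k mod p)"
    using root unfolding power_add power_mult primitive_root_of_unity_def by simp
  finally show ?thesis ..
qed

text \<open>Any exponent representing the trace may be used, reduced or not, as
  \<open>\<zeta> ^ p = 1\<close>; additivity then follows by adding exponents.\<close>

lemma canonical_char_eq:
  assumes "of_nat j = abs_trace p n (x :: 'a)"
  shows "canonical_char p n \<zeta> x = \<zeta> ^ j"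
proof -
  have "(THE k. k < p \<and> of_nat k = abs_trace p n x) = j mod p"
  proof (rule the_equality)
    have "[j mod p = j] (mod p)"
      by (simp add: cong_def)
    then show "j mod p < p \<and> of_nat (j mod p) = abs_trace p n x"
      using assms p_gt_1 of_nat_eq_iff_cong_CHAR[of "j mod p" j, where ?'a = 'a] by (simp add: CHAR_p)
  next
    fix k assume "k < p \<and> of_nat k = abs_trace p n x"
    with assms have "(of_nat k :: 'a) = of_nat j" and "k < p"
      by simp_all
    then show "k = j mod p"
      by (simp add: of_nat_eq_iff_cong_CHAR CHAR_p cong_def)
  qed
  then show ?thesis
    by (simp add: canonical_char_def root_power_mod)
qed

lemma canonical_char_add:
  "canonical_char p n \<zeta> (x + y) = canonical_char p n \<zeta> x * canonical_char p n \<zeta> (y :: 'a)"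
proof -
  obtain i where i: "of_nat i = abs_trace p n x"
    by (rule abs_trace_in_prime_field)
  obtain j where j: "of_nat j = abs_trace p n y"
    by (rule abs_trace_in_prime_field)
  have "of_nat (i + j) = abs_trace p n (x + y)"
    by (simp add: abs_trace_add i j)
  then show ?thesis
    by (simp add: canonical_char_eq[of "i + j"] canonical_char_eq[OF i] canonical_char_eq[OF j] power_add)
qed

lemma canonical_char_0: "canonical_char p n \<zeta> (0 :: 'a) = 1"
  using p_gt_1 by (subst canonical_char_eq[of 0]) (simp_all add: abs_trace_def power_0_left)

lemma canonical_char_power: "canonical_char p n \<zeta> ((x :: 'a) ^ p ^ k) = canonical_char p n \<zeta> x"
  by (simp only: canonical_char_def abs_trace_power_p_power)

text \<open>By primitivity of \<zeta> a trivial character would make the trace vanish identically,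
  but as a nonzero polynomial of degree at most \<open>p ^ (n - 1)\<close> it has too few
  roots.\<close>

lemma canonical_char_nontrivial: "\<exists>x :: 'a. canonical_char p n \<zeta> x \<noteq> 1"
proof (rule ccontr)
  assume "\<nexists>x :: 'a. canonical_char p n \<zeta> x \<noteq> 1"
  then have triv: "canonical_char p n \<zeta> x = 1" for x :: 'a
    by simp
  have zero: "abs_trace p n x = 0" for x :: 'a
  proof -
    obtain k where k: "k < p" "of_nat k = abs_trace p n x"
      by (rule abs_trace_in_prime_field)
    then have "\<zeta> ^ k = 1"
      using triv[of x] canonical_char_eq[OF k(2)] by simp
    then have "k = 0"
      using root k(1) by (auto simp: primitive_root_of_unity_def)
    then show ?thesis
      using k(2) by simp
  qed
  let ?P = "\<Sum>k<n. monom 1 (p ^ k) :: 'a poly"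
  \<comment> \<open>Only the summand \<open>k = 0\<close> is linear; its coefficient shows that the
    trace polynomial is nonzero.\<close>
  have "coeff ?P 1 = (\<Sum>k<n. if k = 0 then 1 else 0)"
    unfolding coeff_sum
  proof (rule sum.cong[OF refl])
    fix k
    have "p ^ k = 1 \<longleftrightarrow> k = 0"
      using p_gt_1 by (cases k) simp_all
    then show "coeff (monom 1 (p ^ k) :: 'a poly) 1 = (if k = 0 then 1 else 0)"
      by (simp only: coeff_monom)
  qed
  then have "coeff ?P 1 = 1"
    using n_pos by simp
  then have "?P \<noteq> 0"
    by (metis coeff_0 zero_neq_one)
  then have "card {x. poly ?P x = 0} \<le> degree ?P"
    by (rule card_poly_roots_bound)
  also have "degree ?P \<le> p ^ (n - 1)"
  proof (rule degree_sum_le)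
    fix k assume "k \<in> {..<n}"
    then have "p ^ k \<le> p ^ (n - 1)"
      using p_gt_1 by (intro power_increasing) auto
    then show "degree (monom 1 (p ^ k) :: 'a poly) \<le> p ^ (n - 1)"
      using degree_monom_le order.trans by blast
  qed simp
  also have "\<dots> < p ^ n"
    using p_gt_1 n_pos by (intro power_strict_increasing) auto
  also have "{x. poly ?P x = 0} = UNIV"
    using zero by (simp add: poly_sum poly_monom abs_trace_def)
  finally show False
    by (simp add: card_p)
qed

end

section \<open>The mean value of the transform\<close>

context additive_character
begin

text \<open>After interchanging the sums, orthogonality annihilates every pair of \<open>S\<close>
  other than (0, 0), which is excluded.\<close>

lemma sum_pair_sum:
  assumes "(0, 0) \<notin> S"
  shows "(\<Sum>(a, b)\<in>UNIV. pair_sum S a b) = 0"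
proof -
  have "(\<Sum>(a, b)\<in>UNIV. pair_sum S a b) = (\<Sum>(a, b)\<in>UNIV \<times> UNIV. \<Sum>(x, y)\<in>S. \<psi> (a * x + b * y))"
    by (simp add: pair_sum_def)
  also have "\<dots> = (\<Sum>a\<in>UNIV. \<Sum>b\<in>UNIV. \<Sum>(x, y)\<in>S. \<psi> (a * x + b * y))"
    by (rule sum.cartesian_product[symmetric])
  also have "\<dots> = (\<Sum>(x, y)\<in>S. (\<Sum>a\<in>UNIV. \<psi> (x * a)) * (\<Sum>b\<in>UNIV. \<psi> (y * b)))"
    unfolding sum_product split_beta
    by (subst sum.swap, subst sum.swap) (simp add: psi_add mult.commute sum.swap[of _ S UNIV])
  also have "\<dots> = 0"
    using assms unfolding sum_psi by (intro sum.neutral) auto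
  finally show ?thesis .
qed

text \<open>Over the nonzero (a, b) the transform sums to minus its value at (0, 0), so its mean is
  -1/4. Neither admissible value is -1/4, so it is not constant and attains both.\<close>

lemma two_valued:
  assumes S: "(0, 0) \<notin> S"
    and card: "pair_sum S 0 0 = (of_nat q ^ 4 - 1) / 4"
    and vals: "\<And>a b. (a, b) \<noteq> (0, 0) \<Longrightarrow>
      pair_sum S a b \<in> {(of_nat q ^ 2 - 1) / 4, (- 3 * of_nat q ^ 2 - 1) / 4}"
  shows "real (card S) = (real q ^ 4 - 1) / 4"
    and "{pair_sum S a b | a b. (a, b) \<noteq> (0, 0)}
      = {(of_nat q ^ 2 - 1) / 4, (- 3 * of_nat q ^ 2 - 1) / 4}"
proof -
  have "complex_of_real (real (card S)) = complex_of_real ((real q ^ 4 - 1) / 4)"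
    using card unfolding pair_sum_0_0 by simp
  then show "real (card S) = (real q ^ 4 - 1) / 4"
    by (simp only: of_real_eq_iff)
  let ?P = "UNIV - {(0, 0)} :: ('a \<times> 'a) set"
  have card_P: "of_nat (card ?P) = (of_nat q ^ 4 - 1 :: complex)"
    using q_gt_1 by (simp add: card_Diff_singleton card_prod card_field of_nat_diff flip: power_add)
  have "(\<Sum>(a, b)\<in>UNIV. pair_sum S a b) = pair_sum S 0 0 + (\<Sum>(a, b)\<in>?P. pair_sum S a b)"
    by (subst sum.remove[of _ "(0, 0)"]) auto
  then have "(of_nat q ^ 4 - 1) / 4 + (\<Sum>(a, b)\<in>?P. pair_sum S a b) = 0"
    unfolding sum_pair_sum[OF S] card by (rule sym)
  then have total: "(\<Sum>(a, b)\<in>?P. pair_sum S a b) = - ((of_nat q ^ 4 - 1) / 4)"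
    by (rule minus_unique[symmetric])
  have q4: "(of_nat q ^ 4 - 1 :: complex) \<noteq> 0"
  proof -
    have "q ^ 4 \<noteq> 1"
      using q_gt_1 by simp
    then have "of_nat (q ^ 4) \<noteq> (1 :: complex)"
      by (simp only: of_nat_eq_1_iff not_False_eq_True)
    then show ?thesis
      by simp
  qed
  have not_const: "v = - 1 / 4" if "\<And>a b. (a, b) \<noteq> (0, 0) \<Longrightarrow> pair_sum S a b = v" for v
  proof -
    have "(\<Sum>(a, b)\<in>?P. pair_sum S a b) = (\<Sum>(a, b)\<in>?P. v)"
    proof (rule sum.cong[OF refl])
      fix z assume "z \<in> ?P"
      then show "(case z of (a, b) \<Rightarrow> pair_sum S a b) = (case z of (a, b) \<Rightarrow> v)"
        using that[of "fst z" "snd z"] by (cases z) simp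
    qed
    also have "\<dots> = (of_nat q ^ 4 - 1) * v"
      by (simp add: split_beta flip: card_P)
    finally have "(of_nat q ^ 4 - 1) * v = (of_nat q ^ 4 - 1) * (- 1 / 4)"
      by (simp add: total)
    with q4 show ?thesis
      by (simp only: mult_cancel_left) simp
  qed
  have q0: "of_nat q \<noteq> (0 :: complex)"
    using q_gt_1 by simp
  have ex1: "\<exists>a b. (a, b) \<noteq> (0, 0) \<and> pair_sum S a b = (of_nat q ^ 2 - 1) / 4"
  proof (rule ccontr)
    assume "\<not> ?thesis"
    then have "(- 3 * of_nat q ^ 2 - 1) / 4 = - 1 / (4 :: complex)"
      using vals by (intro not_const) blast
    then show False
      using q0 by simp
  qed
  have ex2: "\<exists>a b. (a, b) \<noteq> (0, 0) \<and> pair_sum S a b = (- 3 * of_nat q ^ 2 - 1) / 4"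
  proof (rule ccontr)
    assume "\<not> ?thesis"
    then have "(of_nat q ^ 2 - 1) / 4 = - 1 / (4 :: complex)"
      using vals by (intro not_const) blast
    then show False
      using q0 by simp
  qed
  show "{pair_sum S a b | a b. (a, b) \<noteq> (0, 0)}
      = {(of_nat q ^ 2 - 1) / 4, (- 3 * of_nat q ^ 2 - 1) / 4}" (is "?L = ?R")
  proof (intro equalityI subsetI)
    fix z assume "z \<in> ?L"
    then obtain a b where "(a, b) \<noteq> (0, 0)" "z = pair_sum S a b"
      by blast
    then show "z \<in> ?R"
      using vals by simp
  next
    fix z assume "z \<in> ?R"
    then have "\<exists>a b. (a, b) \<noteq> (0, 0) \<and> pair_sum S a b = z"
      using ex1 ex2 by (elim insertE emptyE) (simp_all only:)
    then show "z \<in> ?L"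
      by blast
  qed
qed

end

section \<open>Square classes as residues of exponents\<close>

context quadratic_extension
begin

text \<open>A union of cosets of the nonzero squares of \<open>F\<close>, which are the powers of
  \<open>\<omega> ^ (2 * (q + 1))\<close>.\<close>

definition class_union :: "nat set \<Rightarrow> 'a set"
  where "class_union A = {\<omega> ^ j | j. j mod (2 * (q + 1)) \<in> A}"

lemma generator_in_class_union_iff: "\<omega> ^ j \<in> class_union A \<longleftrightarrow> j mod (2 * (q + 1)) \<in> A"
proof
  assume "\<omega> ^ j \<in> class_union A"
  then obtain i where i: "\<omega> ^ j = \<omega> ^ i" "i mod (2 * (q + 1)) \<in> A"
    by (auto simp: class_union_def)
  have "j mod (2 * (q + 1)) = i mod (2 * (q + 1))"
    using i(1) dvd_group_order by (rule generator_power_eq_imp)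
  with i(2) show "j mod (2 * (q + 1)) \<in> A"
    by simp
qed (auto simp: class_union_def)

lemma class_2_eq: "t < 2 \<Longrightarrow> cyclotomic_class \<omega> 2 t = {y. \<chi> y = (- 1) ^ t}"
proof (intro equalityI subsetI)
  fix y assume t: "t < 2" and "y \<in> {y. \<chi> y = (- 1) ^ t}"
  then have y: "\<chi> y = (- 1) ^ t"
    by simp
  then have "y \<noteq> 0"
    by auto
  then obtain j where j: "y = \<omega> ^ j"
    by (rule obtain_log)
  with y have "even j \<longleftrightarrow> even t"
    by (auto simp: quad_char_power minus_one_power_iff split: if_splits)
  then have "j mod 2 = t"
    using t by presburger
  then have "j = t + 2 * (j div 2)"
    by presburger
  then have "y = \<omega> ^ t * (\<omega> ^ 2) ^ (j div 2)"
    unfolding j by (simp only: power_add[symmetric] power_mult[symmetric])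
  then show "y \<in> cyclotomic_class \<omega> 2 t"
    unfolding cyclotomic_class_def by blast
next
  fix y assume "y \<in> cyclotomic_class \<omega> 2 t"
  then obtain k where "y = \<omega> ^ t * (\<omega>\<^sup>2) ^ k"
    unfolding cyclotomic_class_def by blast
  then show "y \<in> {y. \<chi> y = (- 1) ^ t}"
    using quad_char_power[of "t + 2 * k"] by (simp add: power_add power_mult)
qed

text \<open>The product of the coordinates is \<open>x * x * \<omega> ^ i\<close>, in the class of
  \<open>\<omega> ^ i\<close>, and \<chi>(x y) = \<chi>(y). Conversely the product determines
  \<open>i\<close> and a suitable \<open>x\<close>, and \<open>y\<close> is
  \<open>U / x\<close>.\<close>

lemma product_set_eq:
  assumes t: "t < 2" and A: "A \<subseteq> {0..2 * q + 1}"
  shows "{(x * y, x * inverse y * \<omega> ^ i) | x y i.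
      x \<in> F - {0} \<and> y \<in> cyclotomic_class \<omega> 2 t \<and> i \<in> A}
    = {(U, V). U \<noteq> 0 \<and> V \<noteq> 0 \<and> \<chi> U = (- 1) ^ t \<and> U * V \<in> class_union A}" (is "?L = ?R")
proof (intro equalityI subsetI)
  fix p assume "p \<in> ?L"
  then obtain x y i where p: "p = (x * y, x * inverse y * \<omega> ^ i)"
    and x: "x \<in> F" "x \<noteq> 0" and y: "\<chi> y = (- 1) ^ t" and i: "i \<in> A"
    unfolding class_2_eq[OF t] by blast
  have y0: "y \<noteq> 0"
    using y by auto
  obtain k where k: "x = \<omega> ^ ((q + 1) * k)"
    using x by (rule F_log)
  have "x * y * (x * inverse y * \<omega> ^ i) = x * x * \<omega> ^ i"
    using y0 by simp
  also have "\<dots> = \<omega> ^ (2 * (q + 1) * k + i)"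
    unfolding k power_add[symmetric] by (rule arg_cong[of _ _ "(^) \<omega>"]) (simp add: algebra_simps)
  finally have e: "x * y * (x * inverse y * \<omega> ^ i) = \<omega> ^ (2 * (q + 1) * k + i)" .
  have "(2 * (q + 1) * k + i) mod (2 * (q + 1)) = i mod (2 * (q + 1))"
    by (simp only: mod_mult_self4)
  also have "\<dots> = i"
    using i A by auto
  finally have "x * y * (x * inverse y * \<omega> ^ i) \<in> class_union A"
    unfolding e generator_in_class_union_iff using i by simp
  then show "p \<in> ?R"
    using x y y0 generator_nonzero by (simp add: p quad_char_mult quad_char_F)
next
  fix p assume "p \<in> ?R"
  then obtain U V where p: "p = (U, V)" "U \<noteq> 0" "V \<noteq> 0" "\<chi> U = (- 1) ^ t" "U * V \<in> class_union A"
    by blast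
  then obtain j where j: "U * V = \<omega> ^ j" "j mod (2 * (q + 1)) \<in> A"
    by (auto simp: class_union_def)
  \<comment> \<open>Half of the multiple of \<open>2 * (q + 1)\<close> contained in
    \<open>j\<close>, so that \<open>x * x\<close> accounts for all of \<open>\<omega> ^ j\<close>
    beyond the reduced exponent.\<close>
  define x where "x = \<omega> ^ ((q + 1) * (j div (2 * (q + 1))))"
  have x: "x \<in> F - {0}"
    using generator_nonzero generator_power_in_F_iff[of "(q + 1) * (j div (2 * (q + 1)))"]
    unfolding x_def by (auto simp del: One_nat_def mult_Suc)
  have "x * x * \<omega> ^ (j mod (2 * (q + 1)))
      = \<omega> ^ (2 * (q + 1) * (j div (2 * (q + 1))) + j mod (2 * (q + 1)))"
    unfolding x_def power_add[symmetric]
    by (rule arg_cong[of _ _ "(^) \<omega>"]) (simp only: mult_2 distrib_right)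
  also have "\<dots> = U * V"
    by (simp only: mult_div_mod_eq j)
  finally have xx: "x * x * \<omega> ^ (j mod (2 * (q + 1))) = U * V" .
  have "p = (x * (U / x), x * inverse (U / x) * \<omega> ^ (j mod (2 * (q + 1))))"
  proof -
    have "x * inverse (U / x) * \<omega> ^ (j mod (2 * (q + 1))) = x * x * \<omega> ^ (j mod (2 * (q + 1))) / U"
      by (simp add: divide_inverse mult_ac)
    also have "\<dots> = V"
      unfolding xx using p(2) by simp
    finally show ?thesis
      using x p(1) by simp
  qed
  moreover have "U / x \<in> cyclotomic_class \<omega> 2 t"
    using x p(4) unfolding class_2_eq[OF t] by (simp add: quad_char_divide quad_char_F)
  ultimately show "p \<in> ?L"
    using x j(2) by blast
qed

lemma sub_char_eq_1_iff: "\<eta> x = 1 \<longleftrightarrow> x \<in> nonzero_squares q"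
  by (auto simp: sub_char_def nonzero_squares_def)

lemma ratio_square_iff:
  "\<omega> ^ i / \<omega> ^ j \<in> nonzero_squares q \<longleftrightarrow> i mod (2 * (q + 1)) = j mod (2 * (q + 1))"
proof
  assume sq: "\<omega> ^ i / \<omega> ^ j \<in> nonzero_squares q"
  then have "\<omega> ^ i / \<omega> ^ j \<in> F" "\<omega> ^ i / \<omega> ^ j \<noteq> 0"
    using nonzero_squares_subset by blast+
  then obtain k where k: "\<omega> ^ i / \<omega> ^ j = \<omega> ^ ((q + 1) * k)"
    by (rule F_log)
  with sq have "even k"
    by (simp only: sub_square_iff)
  then obtain d where d: "k = 2 * d" ..
  have "\<omega> ^ i = \<omega> ^ ((q + 1) * k) * \<omega> ^ j"
    using k generator_nonzero by (simp add: field_simps)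
  also have "\<dots> = \<omega> ^ (2 * (q + 1) * d + j)"
    unfolding d by (simp only: power_add[symmetric] ac_simps)
  finally have "i mod (2 * (q + 1)) = (2 * (q + 1) * d + j) mod (2 * (q + 1))"
    using dvd_group_order by (rule generator_power_eq_imp)
  then show "i mod (2 * (q + 1)) = j mod (2 * (q + 1))"
    by (simp only: mod_mult_self4)
next
  let ?K = "2 * (q + 1)"
  assume eq: "i mod ?K = j mod ?K"
  have split: "\<omega> ^ k = \<omega> ^ ((q + 1) * (2 * (k div ?K))) * \<omega> ^ (k mod ?K)" for k
  proof -
    have "k = (q + 1) * (2 * (k div ?K)) + k mod ?K"
      using mult_div_mod_eq[of ?K k] by (simp only: ac_simps)
    then show ?thesis
      by (simp only: power_add[symmetric])
  qed
  have sq: "\<omega> ^ ((q + 1) * (2 * d)) \<in> F" "\<eta> (\<omega> ^ ((q + 1) * (2 * d))) = 1" for d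
    using generator_power_in_F_iff[of "(q + 1) * (2 * d)"] by (simp_all only: dvd_triv_left sub_char_power) simp
  have "\<omega> ^ i / \<omega> ^ j = \<omega> ^ ((q + 1) * (2 * (i div ?K))) / \<omega> ^ ((q + 1) * (2 * (j div ?K)))"
    unfolding split[of i] split[of j] eq using generator_nonzero by (simp only: mult_divide_mult_cancel_right power_not_zero not_False_eq_True)
  then have "\<eta> (\<omega> ^ i / \<omega> ^ j) = 1"
    by (simp only: sub_char_divide sq) simp
  then show "\<omega> ^ i / \<omega> ^ j \<in> nonzero_squares q"
    by (simp only: sub_char_eq_1_iff)
qed

text \<open>The values 0 and 1 mark the residues in \<open>I1\<close> and \<open>I2\<close>, and -1
  those whose trace is a nonsquare of \<open>F\<close>; the index sets and their shifts are handled
  through this one periodic function.\<close>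

definition tr_sign :: "nat \<Rightarrow> complex"
  where "tr_sign i = \<eta> (tr (\<omega> ^ i))"

text \<open>The two powers differ by a nonzero square of \<open>F\<close>, which passes through the
  trace and does not affect \<eta>.\<close>

lemma tr_sign_cong:
  assumes "i mod (2 * (q + 1)) = j mod (2 * (q + 1))"
  shows "tr_sign i = tr_sign j"
proof -
  define s where "s = \<omega> ^ i / \<omega> ^ j"
  have "s \<in> nonzero_squares q"
    using assms by (simp only: s_def ratio_square_iff)
  then have s: "s \<in> F" "\<eta> s = 1"
    using nonzero_squares_subset by (auto simp: sub_char_eq_1_iff)
  have "\<omega> ^ i = s * \<omega> ^ j"
    using generator_nonzero by (simp add: s_def)
  then show ?thesis
    using s by (simp add: tr_sign_def tr_scale sub_char_mult)
qed

lemma tr_sign_values: "tr_sign i = 0 \<or> tr_sign i = 1 \<or> tr_sign i = - 1"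
  using sub_char_values[of "tr (\<omega> ^ i)"] unfolding tr_sign_def
  by (cases "tr (\<omega> ^ i) = 0") simp_all

text \<open>Periodicity of \<open>R\<close> lets the condition be tested at \<open>i + c\<close>
  without reduction.\<close>

lemma shift_down_iff:
  assumes "\<And>i j. i mod (2 * (q + 1)) = j mod (2 * (q + 1)) \<Longrightarrow> R i \<longleftrightarrow> R j"
  shows "i \<in> shift_down q c {i \<in> {0..2 * q + 1}. R i} \<longleftrightarrow> i < 2 * (q + 1) \<and> R (i + c)"
proof
  let ?K = "2 * (q + 1)"
  assume "i \<in> shift_down q c {i \<in> {0..2 * q + 1}. R i}"
  then obtain j where "j \<in> {0..2 * q + 1}" and j: "R j"
    and "i = nat ((int j - int c) mod (2 * (int q + 1)))"
    unfolding shift_down_def by blast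
  then have jK: "j < ?K" and i: "i = nat ((int j - int c) mod int ?K)"
    by (simp_all add: algebra_simps)
  have "int i = (int j - int c) mod int ?K"
    unfolding i by (simp del: of_nat_mult of_nat_add)
  then have "int (i + c) mod int ?K = int j mod int ?K" and "int i < int ?K"
    by (simp_all del: of_nat_mult of_nat_add add: of_nat_add[of i c] mod_add_left_eq)
  then have "(i + c) mod ?K = j mod ?K" "i < ?K"
    by (simp_all only: zmod_int[symmetric] of_nat_eq_iff of_nat_less_iff)
  then show "i < ?K \<and> R (i + c)"
    using assms[of "i + c" j] j by simp
next
  let ?K = "2 * (q + 1)"
  assume i: "i < ?K \<and> R (i + c)"
  define j where "j = (i + c) mod ?K"
  have "j < ?K"
    by (simp add: j_def)
  moreover have "R j"
    using i assms[of j "i + c"] by (simp add: j_def)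
  moreover have "i = nat ((int j - int c) mod (2 * (int q + 1)))"
  proof -
    have K: "int ?K = 2 * (int q + 1)"
      by simp
    have "int j = (int i + int c) mod int ?K"
      by (simp only: j_def zmod_int of_nat_add)
    then have "(int j - int c) mod int ?K = (int i + int c - int c) mod int ?K"
      by (simp only: mod_diff_left_eq)
    also have "\<dots> = int i mod int ?K"
      by simp
    also have "\<dots> = int (i mod ?K)"
      by (simp only: zmod_int)
    finally show ?thesis
      using i by (simp only: K mod_less nat_int)
  qed
  ultimately show "i \<in> shift_down q c {i \<in> {0..2 * q + 1}. R i}"
    unfolding shift_down_def by (intro image_eqI[of _ _ j]) (assumption, simp)
qed

lemma I1_eq: "I1 q \<omega> = {i \<in> {0..2 * q + 1}. tr_sign i = 0}"
  by (simp add: I1_def tr_sign_def)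

lemma I2_eq: "I2 q \<omega> = {i \<in> {0..2 * q + 1}. tr_sign i = 1}"
  by (simp add: I2_def tr_sign_def sub_char_eq_1_iff)

lemma shift_down_I1_iff: "i \<in> shift_down q c (I1 q \<omega>) \<longleftrightarrow> i < 2 * (q + 1) \<and> tr_sign (i + c) = 0"
  unfolding I1_eq by (intro shift_down_iff) (drule tr_sign_cong, simp)

lemma shift_down_I2_iff: "i \<in> shift_down q c (I2 q \<omega>) \<longleftrightarrow> i < 2 * (q + 1) \<and> tr_sign (i + c) = 1"
  unfolding I2_eq by (intro shift_down_iff) (drule tr_sign_cong, simp)

lemma X1_iff: "i \<in> X1 q \<omega> c \<longleftrightarrow> i < 2 * (q + 1) \<and>
    (tr_sign i = 0 \<and> tr_sign (i + c) = 1 \<or> tr_sign i = 1 \<and> tr_sign (i + c) = 0)"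
  unfolding X1_def by (auto simp: shift_down_I1_iff shift_down_I2_iff) (auto simp: I1_eq I2_eq)

lemma X3_iff: "i \<in> X3 q \<omega> c \<longleftrightarrow> i < 2 * (q + 1) \<and> tr_sign i = 1 \<and> tr_sign (i + c) = 1"
  unfolding X3_def by (auto simp: shift_down_I2_iff) (auto simp: I2_eq)

text \<open>As \<open>u / v\<close> is in \<open>F\<close>, it is also the ratio of
  \<open>tr (\<theta> * u)\<close> to \<open>tr (\<theta> * v)\<close>. Hence each half of
  \<open>X1\<close> contains at most one residue.\<close>

lemma trace_zero_square_class_unique:
  assumes "tr u = 0" "tr v = 0" "v \<noteq> 0" "\<eta> (tr (\<theta> * u)) = 1" "\<eta> (tr (\<theta> * v)) = 1"
  shows "u / v \<in> nonzero_squares q"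
proof -
  have F: "u / v \<in> F"
    using assms by (intro tr_zero_ratio)
  have "\<theta> * u = u / v * (\<theta> * v)"
    using assms by simp
  then have "\<eta> (tr (\<theta> * u)) = \<eta> (u / v * tr (\<theta> * v))"
    using F by (simp only: tr_scale)
  then have "\<eta> (u / v) = 1"
    using F assms by (simp only: sub_char_mult tr_in_F mult_1_right)
  then show ?thesis
    by (simp only: sub_char_eq_1_iff)
qed

lemma trace_zero_square_class_exists:
  assumes "\<theta> \<notin> F"
  obtains l where "l \<noteq> 0" "tr l = 0" "\<eta> (tr (\<theta> * l)) = 1"
proof -
  let ?l = "\<omega> ^ ((q + 1) div 2)"
  have l: "tr ?l = 0" "?l \<noteq> 0"
    using tr_zero_generator generator_nonzero by auto
  have nz: "tr (\<theta> * ?l) \<noteq> 0"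
  proof
    assume "tr (\<theta> * ?l) = 0"
    then have "\<theta> * ?l / ?l \<in> F"
      using l by (intro tr_zero_ratio)
    with l assms show False
      by simp
  qed
  \<comment> \<open>The trace of \<open>\<theta> * ?l\<close> is nonzero, so scaling by its inverse
    makes it 1, a square.\<close>
  define s where "s = inverse (tr (\<theta> * ?l))"
  have s: "s \<in> F" "s \<noteq> 0"
    using nz by (simp_all add: s_def)
  have "\<theta> * (s * ?l) = s * (\<theta> * ?l)"
    by (rule mult.left_commute)
  then have "tr (\<theta> * (s * ?l)) = 1"
    using nz s by (simp only: tr_scale) (simp add: s_def)
  then show thesis
    using that[of "s * ?l"] l s by (simp add: tr_scale)
qed

end

lemma sum_of_bool_mult_count:
  fixes f :: "nat \<Rightarrow> complex"
  assumes "A \<subseteq> {..<n}"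
  shows "(\<Sum>i<n. f i * of_bool (i \<in> A)) = (\<Sum>i\<in>A. f i)"
  using assms by (intro sum.mono_neutral_cong_right) auto

lemma sum_alternating:
  assumes "finite A"
  shows "(\<Sum>i\<in>A. (- 1) ^ i) = (of_nat (card (evens A)) - of_nat (card (odds A)) :: complex)"
proof -
  have A: "A = evens A \<union> odds A" "evens A \<inter> odds A = {}"
    by (auto simp: evens_def odds_def)
  have fin: "finite (evens A)" "finite (odds A)"
    using assms by (auto simp: evens_def odds_def)
  have "(\<Sum>i\<in>A. (- 1) ^ i) = (\<Sum>i\<in>evens A. (- 1) ^ i) + (\<Sum>i\<in>odds A. (- 1 :: complex) ^ i)"
    using A fin by (metis sum.union_disjoint)
  also have "(\<Sum>i\<in>evens A. (- 1) ^ i) = (\<Sum>i\<in>evens A. 1 :: complex)"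
    by (intro sum.cong) (auto simp: evens_def)
  also have "(\<Sum>i\<in>odds A. (- 1) ^ i) = (\<Sum>i\<in>odds A. - 1 :: complex)"
    by (intro sum.cong) (auto simp: odds_def)
  finally show ?thesis
    by simp
qed

context additive_character
begin

text \<open>\<open>X1\<close> consists of the residues of \<open>l\<^sub>1\<close> and
  \<open>l\<^sub>2\<close>, and elsewhere \<open>A\<close> and \<open>B\<close> agree. Weighting the
  difference of indicators by 1 and by \<open>(- 1) ^ i\<close> gives the two counting
  identities.\<close>

lemma configuration:
  assumes c: "odd c" and A: "A \<subseteq> {0..2 * q + 1}" and B: "B \<subseteq> {0..2 * q + 1}"
    and mset_eq: "mset_set A + mset_set B
      = mset_set (X1 q \<omega> c) + mset_set (X3 q \<omega> c) + mset_set (X3 q \<omega> c)"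
  obtains l\<^sub>1 l\<^sub>2 d\<^sub>1 d\<^sub>2 where
    "type_Q_configuration q \<omega> \<psi> (\<omega> ^ c) l\<^sub>1 l\<^sub>2 d\<^sub>1 d\<^sub>2 (class_union A) (class_union B)"
    "of_nat (card A) - of_nat (card B) = d\<^sub>1 + d\<^sub>2"
    "of_nat (card (evens A)) - of_nat (card (odds A))
      - (of_nat (card (evens B)) - of_nat (card (odds B))) = \<epsilon> * (d\<^sub>2 - d\<^sub>1)"
proof -
  let ?K = "2 * (q + 1)" and ?\<theta> = "\<omega> ^ c"
  have theta: "\<chi> ?\<theta> = - 1"
    using c by (simp add: quad_char_power)
  have theta_F: "?\<theta> \<notin> F" "inverse ?\<theta> \<notin> F"
    using quad_nonresidue_notin_F[OF theta] by (simp_all only: F_inverse not_False_eq_True)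
  have theta0: "?\<theta> \<noteq> 0"
    using generator_nonzero by simp
  obtain l\<^sub>1 where l1: "l\<^sub>1 \<noteq> 0" "tr l\<^sub>1 = 0" "\<eta> (tr (?\<theta> * l\<^sub>1)) = 1"
    using theta_F(1) by (rule trace_zero_square_class_exists)
  \<comment> \<open>The second class is the first one for the inverse of \<theta>, which exchanges
    the roles of \<open>z\<close> and \<open>\<theta> * z\<close>.\<close>
  obtain l' where l': "l' \<noteq> 0" "tr l' = 0" "\<eta> (tr (inverse ?\<theta> * l')) = 1"
    using theta_F(2) by (rule trace_zero_square_class_exists)
  define l\<^sub>2 where "l\<^sub>2 = inverse ?\<theta> * l'"
  have \<theta>l2: "?\<theta> * l\<^sub>2 = l'"
    using theta0 by (simp add: l\<^sub>2_def)
  have l2: "l\<^sub>2 \<noteq> 0" "tr (?\<theta> * l\<^sub>2) = 0" "\<eta> (tr l\<^sub>2) = 1"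
    using l' theta0 unfolding \<theta>l2 by (simp_all add: l\<^sub>2_def)
  obtain j\<^sub>1 where j1: "l\<^sub>1 = \<omega> ^ j\<^sub>1"
    using l1(1) by (rule obtain_log)
  obtain j\<^sub>2 where j2: "l\<^sub>2 = \<omega> ^ j\<^sub>2"
    using l2(1) by (rule obtain_log)
  define i\<^sub>1 where "i\<^sub>1 = j\<^sub>1 mod ?K"
  define i\<^sub>2 where "i\<^sub>2 = j\<^sub>2 mod ?K"
  have ts: "tr_sign (j mod ?K) = \<eta> (tr (\<omega> ^ j))" "tr_sign (j mod ?K + c) = \<eta> (tr (?\<theta> * \<omega> ^ j))" for j
  proof -
    show "tr_sign (j mod ?K) = \<eta> (tr (\<omega> ^ j))"
      unfolding tr_sign_def[symmetric] by (rule tr_sign_cong) (rule mod_mod_trivial)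
    have "tr_sign (j mod ?K + c) = tr_sign (j + c)"
      by (rule tr_sign_cong) (rule mod_add_left_eq)
    then show "tr_sign (j mod ?K + c) = \<eta> (tr (?\<theta> * \<omega> ^ j))"
      by (simp only: tr_sign_def power_add mult.commute)
  qed
  have s1: "tr_sign i\<^sub>1 = 0" "tr_sign (i\<^sub>1 + c) = 1"
    using l1 unfolding i\<^sub>1_def ts j1 by simp_all
  have s2: "tr_sign i\<^sub>2 = 1" "tr_sign (i\<^sub>2 + c) = 0"
    using l2 unfolding i\<^sub>2_def ts j2 by simp_all
  have less: "i\<^sub>1 < ?K" "i\<^sub>2 < ?K"
    by (simp_all add: i\<^sub>1_def i\<^sub>2_def)
  have neq: "i\<^sub>1 \<noteq> i\<^sub>2"
    using s1 s2 by auto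
  have in_X1: "i\<^sub>1 \<in> X1 q \<omega> c" "i\<^sub>2 \<in> X1 q \<omega> c"
    using s1 s2 less by (simp_all only: X1_iff) simp_all
  have X1_cases: "i = i\<^sub>1 \<or> i = i\<^sub>2" if "i \<in> X1 q \<omega> c" for i
  proof -
    have i: "i < ?K"
      using that by (simp only: X1_iff)
    then have im: "i mod ?K = i"
      by (rule mod_less)
    have ti: "tr_sign i = \<eta> (tr (\<omega> ^ i))" "tr_sign (i + c) = \<eta> (tr (?\<theta> * \<omega> ^ i))"
      using ts[of i] by (simp_all only: im)
    consider "tr_sign i = 0" "tr_sign (i + c) = 1" | "tr_sign i = 1" "tr_sign (i + c) = 0"
      using \<open>i \<in> X1 q \<omega> c\<close> by (auto simp only: X1_iff)
    then show ?thesis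
    proof cases
      case 1
      then have "\<omega> ^ i / l\<^sub>1 \<in> nonzero_squares q"
        using l1 ti by (intro trace_zero_square_class_unique[of _ _ ?\<theta>]) auto
      then have "i mod ?K = i\<^sub>1"
        by (simp only: j1 ratio_square_iff i\<^sub>1_def)
      then show ?thesis
        by (simp only: im simp_thms)
    next
      case 2
      have inv: "inverse ?\<theta> * (?\<theta> * z) = z" for z
        using theta0 by (metis left_inverse mult.assoc mult_1)
      have "?\<theta> * \<omega> ^ i / (?\<theta> * l\<^sub>2) \<in> nonzero_squares q"
      proof (rule trace_zero_square_class_unique[of _ _ "inverse ?\<theta>"], unfold inv)
        show "tr (?\<theta> * \<omega> ^ i) = 0" "\<eta> (tr (\<omega> ^ i)) = 1"
          using 2 ti by simp_all
      qed (use l2 theta0 in auto)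
      then have "\<omega> ^ i / l\<^sub>2 \<in> nonzero_squares q"
        using generator_nonzero by simp
      then have "i mod ?K = i\<^sub>2"
        by (simp only: j2 ratio_square_iff i\<^sub>2_def)
      then show ?thesis
        by (simp only: im simp_thms)
    qed
  qed
  have fin: "finite A" "finite B" "finite (X1 q \<omega> c)" "finite (X3 q \<omega> c)"
    using A B by (auto intro: finite_subset simp: X1_def X3_def I1_def I2_def)
  have count: "of_bool (i \<in> A) + of_bool (i \<in> B)
      = (of_bool (i \<in> X1 q \<omega> c) + 2 * of_bool (i \<in> X3 q \<omega> c) :: complex)" for i
  proof -
    have "(of_bool (i \<in> A) + of_bool (i \<in> B) :: nat)
        = of_bool (i \<in> X1 q \<omega> c) + 2 * of_bool (i \<in> X3 q \<omega> c)"
      using arg_cong[OF mset_eq, of "\<lambda>M. count M i"] fin by (auto simp: count_mset_set' split: if_splits)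
    then have "complex_of_nat (of_bool (i \<in> A) + of_bool (i \<in> B))
        = complex_of_nat (of_bool (i \<in> X1 q \<omega> c) + 2 * of_bool (i \<in> X3 q \<omega> c))"
      by (simp only:)
    then show ?thesis
      by simp
  qed
  define d\<^sub>1 :: complex where "d\<^sub>1 = of_bool (i\<^sub>1 \<in> A) - of_bool (i\<^sub>1 \<in> B)"
  define d\<^sub>2 :: complex where "d\<^sub>2 = of_bool (i\<^sub>2 \<in> A) - of_bool (i\<^sub>2 \<in> B)"
  have diff: "of_bool (i \<in> A) - of_bool (i \<in> B) = d\<^sub>1 * of_bool (i = i\<^sub>1) + d\<^sub>2 * of_bool (i = i\<^sub>2)" for i
  proof (cases "i \<in> X1 q \<omega> c")
    case True
    then show ?thesis
      using X1_cases neq by (auto simp: d\<^sub>1_def d\<^sub>2_def)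
  next
    \<comment> \<open>Off \<open>X1\<close> the multiplicity is even, so \<open>i\<close> lies in
      both sets or in neither.\<close>
    case False
    then have "i \<noteq> i\<^sub>1" "i \<noteq> i\<^sub>2"
      using in_X1 by auto
    then show ?thesis
      using False count[of i] by (cases "i \<in> A"; cases "i \<in> B"; cases "i \<in> X3 q \<omega> c") simp_all
  qed
  have conf: "type_Q_configuration q \<omega> \<psi> ?\<theta> l\<^sub>1 l\<^sub>2 d\<^sub>1 d\<^sub>2 (class_union A) (class_union B)"
  proof unfold_locales
    fix z :: 'a assume z: "z \<noteq> 0"
    then obtain j where j: "z = \<omega> ^ j"
      by (rule obtain_log)
    define i where "i = j mod ?K"
    have ti: "tr_sign i = \<eta> (tr z)" "tr_sign (i + c) = \<eta> (tr (?\<theta> * z))"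
      by (simp_all only: i_def ts j)
    have "i < ?K"
      by (simp add: i_def)
    have mem: "z \<in> class_union S \<longleftrightarrow> i \<in> S" for S
      by (simp only: j generator_in_class_union_iff i_def)
    \<comment> \<open>Two vanishing signs would give the value 1/2 in the formula below.\<close>
    have not_both: "\<not> (tr_sign i = 0 \<and> tr_sign (i + c) = 0)"
    proof
      assume "tr_sign i = 0 \<and> tr_sign (i + c) = 0"
      then have "tr z = 0" "tr (?\<theta> * z) = 0"
        using ti by simp_all
      then have "?\<theta> * z / z \<in> F"
        by (intro tr_zero_ratio)
      then show False
        using theta_F z by simp
    qed
    show "of_bool (z \<in> class_union A) + of_bool (z \<in> class_union B)
        = (1 + \<eta> (tr z)) * (1 + \<eta> (tr (?\<theta> * z))) / 2"
      unfolding mem count ti[symmetric] X1_iff X3_iff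
      using tr_sign_values[of i] tr_sign_values[of "i + c"] not_both \<open>i < ?K\<close>
      by (elim disjE) simp_all
    show "of_bool (z \<in> class_union A) - of_bool (z \<in> class_union B)
        = d\<^sub>1 * of_bool (z / l\<^sub>1 \<in> nonzero_squares q) + d\<^sub>2 * of_bool (z / l\<^sub>2 \<in> nonzero_squares q)"
      unfolding mem diff unfolding j j1 j2 ratio_square_iff by (simp only: i_def i\<^sub>1_def i\<^sub>2_def)
  qed (use theta l1 l2 in auto)
  have weighted: "(\<Sum>i\<in>A. f i) - (\<Sum>i\<in>B. f i) = d\<^sub>1 * f i\<^sub>1 + d\<^sub>2 * f i\<^sub>2" for f :: "nat \<Rightarrow> complex"
  proof -
    have AB: "A \<subseteq> {..<?K}" "B \<subseteq> {..<?K}"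
      using A B by auto
    have "(\<Sum>i\<in>A. f i) - (\<Sum>i\<in>B. f i) = (\<Sum>i<?K. f i * (of_bool (i \<in> A) - of_bool (i \<in> B)))"
      unfolding sum_of_bool_mult_count[OF AB(1), symmetric] sum_of_bool_mult_count[OF AB(2), symmetric]
      by (simp only: sum_subtractf right_diff_distrib)
    also have "\<dots> = (\<Sum>i<?K. if i = i\<^sub>1 then f i * d\<^sub>1 else 0) + (\<Sum>i<?K. if i = i\<^sub>2 then f i * d\<^sub>2 else 0)"
      unfolding diff sum.distrib[symmetric] by (intro sum.cong) (auto simp: algebra_simps)
    also have "\<dots> = d\<^sub>1 * f i\<^sub>1 + d\<^sub>2 * f i\<^sub>2"
      using less by (simp add: mult.commute)
    finally show ?thesis .
  qed
  have sizes: "of_nat (card A) - of_nat (card B) = d\<^sub>1 + d\<^sub>2"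
    using weighted[of "\<lambda>_. 1"] by simp
  have parities: "of_nat (card (evens A)) - of_nat (card (odds A))
      - (of_nat (card (evens B)) - of_nat (card (odds B))) = \<epsilon> * (d\<^sub>2 - d\<^sub>1)"
  proof -
    \<comment> \<open>The modulus is even, so reduction keeps parity and the weights of
      \<open>i\<^sub>1\<close>, \<open>i\<^sub>2\<close> are the \<chi> values of
      \<open>l\<^sub>1\<close>, \<open>l\<^sub>2\<close>.\<close>
    have parity: "(- 1) ^ (j mod ?K) = \<chi> (\<omega> ^ j)" for j
    proof -
      have "even (j mod ?K) \<longleftrightarrow> even j"
        by (intro dvd_mod_iff) simp
      then show ?thesis
        by (simp add: quad_char_power minus_one_power_iff)
    qed
    have "\<chi> l\<^sub>1 = - \<epsilon>"
      using l1 by (intro quad_char_tr_zero)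
    moreover have "\<chi> (?\<theta> * l\<^sub>2) = - \<epsilon>"
      using l2 theta0 by (intro quad_char_tr_zero) auto
    then have "\<chi> l\<^sub>2 = \<epsilon>"
      unfolding quad_char_mult theta by simp
    ultimately have "(- 1) ^ i\<^sub>1 = - \<epsilon>" "(- 1) ^ i\<^sub>2 = \<epsilon>"
      by (simp_all only: i\<^sub>1_def i\<^sub>2_def parity j1 j2)
    then show ?thesis
      using weighted[of "\<lambda>i. (- 1) ^ i"] unfolding sum_alternating[OF fin(1)] sum_alternating[OF fin(2)]
      by (simp add: algebra_simps)
  qed
  show thesis
    using conf sizes parities by (rule that)
qed

section \<open>The sets \<open>D0\<close> to \<open>D3\<close> in coordinates\<close>

lemma D2_Un_D3_eq:
  assumes "A \<subseteq> {0..2 * q + 1}" "B \<subseteq> {0..2 * q + 1}"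
  shows "D2 q \<omega> A \<union> D3 q \<omega> B = mixed_set (class_union A) (class_union B)"
  using product_set_eq[of 0 A] product_set_eq[of 1 B] assms
  by (auto simp: D2_def D3_def mixed_set_def)

text \<open>The choice of \<tau> by \<open>q\<close> modulo 4 is uniform in terms of \<epsilon>, the
  form in which the axis cancels the twisted sums.\<close>

lemma D0_eq: "D0 q \<omega> = Pair 0 ` {y. \<chi> y = - \<epsilon>}"
proof (cases "q mod 4 = 3")
  case True
  then have "odd ((q - 1) div 2)"
    by presburger
  then have "- \<epsilon> = 1"
    by (simp add: \<epsilon>_def)
  then show ?thesis
    using True by (auto simp: D0_def class_2_eq)
next
  case False
  with odd_q have "even ((q - 1) div 2)"
    by presburger
  then have "- \<epsilon> = - 1"
    by (simp add: \<epsilon>_def)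
  then show ?thesis
    using False by (auto simp: D0_def class_2_eq)
qed

lemma D1_eq: "D1 \<omega> = (\<lambda>y. (y, 0)) ` {y. \<chi> y = 1}"
  by (auto simp: D1_def class_2_eq)

lemma pair_sum_axis:
  "pair_sum (Pair 0 ` T) a b = (\<Sum>y\<in>T. \<psi> (b * y))"
  "pair_sum ((\<lambda>y. (y, 0)) ` T) a b = (\<Sum>y\<in>T. \<psi> (a * y))"
  by (simp_all add: pair_sum_def sum.reindex inj_on_def)

text \<open>The product of the coordinates changes by \<open>t * t\<close>, which keeps its square
  class, and \<chi>(t) = 1.\<close>

lemma mixed_set_scale:
  assumes t: "t \<in> F - {0}" and xy: "(x, y) \<in> mixed_set (class_union A) (class_union B)"
  shows "(t * x, t * y) \<in> mixed_set (class_union A) (class_union B)"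
proof -
  obtain k where k: "t = \<omega> ^ ((q + 1) * k)"
    using t by (auto elim: F_log)
  have scale: "t * x * (t * y) \<in> class_union S" if S: "x * y \<in> class_union S" for S
  proof -
    obtain j where j: "x * y = \<omega> ^ j" "j mod (2 * (q + 1)) \<in> S"
      using S unfolding class_union_def by blast
    have "t * x * (t * y) = t * t * \<omega> ^ j"
      unfolding j(1)[symmetric] by (simp only: ac_simps)
    also have "\<dots> = \<omega> ^ (2 * (q + 1) * k + j)"
      unfolding k power_add[symmetric] by (rule arg_cong[of _ _ "(^) \<omega>"]) (simp add: algebra_simps)
    finally show ?thesis
      using j(2) by (simp only: generator_in_class_union_iff mod_mult_self4)
  qed
  have "\<chi> (t * x) = \<chi> x"
    using t by (simp add: quad_char_mult quad_char_F)
  with xy t scale show ?thesis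
    by (auto simp: mixed_set_def)
qed

end

section \<open>The two type Q sets\<close>

theorem theorem4p1:
  fixes p m q c :: nat and \<omega> :: "'a::finite_field" and \<zeta> :: complex and A B :: "nat set"
  assumes "prime p" and "m \<ge> 1" and "q = p ^ m" and "odd q"
    and "CARD('a) = q\<^sup>2"
    and "primitive_elem \<omega>"
    and "primitive_root_of_unity p \<zeta>"
    and "odd c" and "c \<in> {0..2*q+1}"
    and "A \<subseteq> {0..2*q+1}" and "B \<subseteq> {0..2*q+1}"
    and "A \<inter> B = X3 q \<omega> c"
    and "mset_set A + mset_set B =
           mset_set (X1 q \<omega> c) + mset_set (X3 q \<omega> c) + mset_set (X3 q \<omega> c)"
  shows "(real (card A) = (real q + 1) / 2 \<and> real (card B) = (real q + 1) / 2 \<and>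
          int (card (evens A)) + int (card (odds B)) =
            int (card (odds A)) + int (card (evens B)) - 2 * (- 1) ^ ((q - 1) div 2)
          \<longrightarrow> type_Q p m \<zeta> (D0 q \<omega> \<union> D2 q \<omega> A \<union> D3 q \<omega> B))
       \<and> (real (card A) = (real q + 3) / 2 \<and> real (card B) = (real q - 1) / 2 \<and>
          card (evens A) + card (odds B) = card (odds A) + card (evens B)
          \<longrightarrow> type_Q p m \<zeta> (D1 \<omega> \<union> D2 q \<omega> A \<union> D3 q \<omega> B))"
proof -
  have "CARD('a) = p ^ (2 * m)"
    using assms(3,5) by (simp add: mult.commute flip: power_mult)
  then interpret cc: canonical_character p "2 * m" \<zeta> "TYPE('a)"
    using assms by unfold_locales auto
  have "q > 1"
    using assms(2,3) cc.p_gt_1 one_less_power[of p m] by simp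
  then interpret additive_character q \<omega> "canonical_char p (2 * m) \<zeta>"
    using assms(4-6) cc.frobenius[of _ _ m] cc.canonical_char_power[of _ m] cc.canonical_char_nontrivial
    by unfold_locales (simp_all add: assms(3) cc.canonical_char_add cc.canonical_char_0)
  obtain l\<^sub>1 l\<^sub>2 d\<^sub>1 d\<^sub>2 where
    conf: "type_Q_configuration q \<omega> (canonical_char p (2 * m) \<zeta>) (\<omega> ^ c) l\<^sub>1 l\<^sub>2 d\<^sub>1 d\<^sub>2
      (class_union A) (class_union B)"
    and sizes: "of_nat (card A) - of_nat (card B) = d\<^sub>1 + d\<^sub>2"
    and parities: "of_nat (card (evens A)) - of_nat (card (odds A))
      - (of_nat (card (evens B)) - of_nat (card (odds B))) = \<epsilon> * (d\<^sub>2 - d\<^sub>1)"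
    using assms(8,10,11,13) by (rule configuration)
  interpret type_Q_configuration q \<omega> "canonical_char p (2 * m) \<zeta>" "\<omega> ^ c" l\<^sub>1 l\<^sub>2 d\<^sub>1 d\<^sub>2
      "class_union A" "class_union B"
    by (rule conf)
  let ?M = "mixed_set (class_union A) (class_union B)"
  \<comment> \<open>Only membership in the two values remains to be checked; that both are attained
    comes from \<open>two_valued\<close>.\<close>
  have type_Q: "type_Q p m \<zeta> S"
    if "(0, 0) \<notin> S" "\<And>t x y. t \<in> F - {0} \<Longrightarrow> (x, y) \<in> S \<Longrightarrow> (t * x, t * y) \<in> S"
      "pair_sum S 0 0 = (of_nat q ^ 4 - 1) / 4"
      "\<And>a b. (a, b) \<noteq> (0, 0) \<Longrightarrow> pair_sum S a b \<in> two_values" for S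
  proof -
    have "char_sum p (2 * m) \<zeta> a b S = pair_sum S a b" for a b
      by (simp add: char_sum_def pair_sum_def)
    then show ?thesis
      using that two_valued[OF that(1,3,4)]
      unfolding type_Q_def Let_def assms(3)[symmetric] by auto
  qed
  show ?thesis
  proof (intro conjI impI)
    assume H: "real (card A) = (real q + 1) / 2 \<and> real (card B) = (real q + 1) / 2 \<and>
      int (card (evens A)) + int (card (odds B)) =
        int (card (odds A)) + int (card (evens B)) - 2 * (- 1) ^ ((q - 1) div 2)"
    \<comment> \<open>Equal sizes give \<open>d\<^sub>1 + d\<^sub>2 = 0\<close> and the parity
      condition gives \<open>d\<^sub>2 - d\<^sub>1 = - 2\<close>, which are the opposite signs
      matching \<open>D0\<close>.\<close>
    then have "card A = card B"
      by linarith
    then have sum0: "d\<^sub>1 + d\<^sub>2 = 0"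
      using sizes by simp
    have "complex_of_int (int (card (evens A)) + int (card (odds B))) =
        complex_of_int (int (card (odds A)) + int (card (evens B)) - 2 * (- 1) ^ ((q - 1) div 2))"
      using H by (simp only:)
    then have "of_nat (card (evens A)) - of_nat (card (odds A))
        - (of_nat (card (evens B)) - of_nat (card (odds B))) = - 2 * \<epsilon>"
      by (simp add: \<epsilon>_def algebra_simps)
    then have "\<epsilon> * (d\<^sub>2 - d\<^sub>1) = \<epsilon> * - 2"
      unfolding parities by (simp only: mult.commute)
    moreover have "\<epsilon> \<noteq> 0"
      using eps_cases by auto
    ultimately have diff: "d\<^sub>2 - d\<^sub>1 = - 2"
      by (simp only: mult_cancel_left simp_thms)
    have "2 * d\<^sub>1 = (d\<^sub>1 + d\<^sub>2) - (d\<^sub>2 - d\<^sub>1)"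
      by simp
    then have "2 * d\<^sub>1 = 2"
      unfolding sum0 diff by simp
    then have "d\<^sub>1 = 1"
      by simp
    with sum0 have d: "d\<^sub>1 = 1" "d\<^sub>2 = - 1"
      by (simp_all add: add_eq_0_iff)
    have s: "- \<epsilon> = 1 \<or> - \<epsilon> = - 1"
      using eps_cases by auto
    have disj: "D0 q \<omega> \<inter> ?M = {}"
      by (auto simp: D0_eq mixed_set_def)
    have ps: "pair_sum (D0 q \<omega> \<union> ?M) a b
        = pair_sum ?M a b + (\<Sum>y\<in>{y. \<chi> y = - \<epsilon>}. canonical_char p (2 * m) \<zeta> (b * y))" for a b
      unfolding pair_sum_Un[OF disj] unfolding D0_eq pair_sum_axis by (rule add.commute)
    have "type_Q p m \<zeta> (D0 q \<omega> \<union> ?M)"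
    proof (rule type_Q)
      show "(0, 0) \<notin> D0 q \<omega> \<union> ?M"
        using s by (auto simp: D0_eq mixed_set_def)
      show "(t * x, t * y) \<in> D0 q \<omega> \<union> ?M" if "t \<in> F - {0}" "(x, y) \<in> D0 q \<omega> \<union> ?M" for t x y
        using that mixed_set_scale by (auto simp: D0_eq quad_char_mult quad_char_F)
      \<comment> \<open>The mixed set contributes \<open>(q\<^sup>2 - 1)\<^sup>2 / 4\<close> and the
        axis \<open>(q\<^sup>2 - 1) / 2\<close>.\<close>
      show "pair_sum (D0 q \<omega> \<union> ?M) 0 0 = (of_nat q ^ 4 - 1) / 4"
        unfolding ps pair_sum_mixed_0_0 sum_psi_class[OF s]
        by (simp add: field_simps power2_eq_square power4_eq_xxxx)
      show "pair_sum (D0 q \<omega> \<union> ?M) a b \<in> two_values" if "(a, b) \<noteq> (0, 0)" for a b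
        unfolding ps using that d by (rule char_values_D0)
    qed
    then show "type_Q p m \<zeta> (D0 q \<omega> \<union> D2 q \<omega> A \<union> D3 q \<omega> B)"
      by (simp only: Un_assoc D2_Un_D3_eq[OF assms(10,11)])
  next
    assume H: "real (card A) = (real q + 3) / 2 \<and> real (card B) = (real q - 1) / 2 \<and>
      card (evens A) + card (odds B) = card (odds A) + card (evens B)"
    then have "real (card A) - real (card B) = 2"
      by (simp add: field_simps)
    \<comment> \<open>Here the sum of the signs is 2 and their difference 0, so both are 1, as
      needed for \<open>D1\<close>.\<close>
    then have "card A = card B + 2"
      by linarith
    then have sum2: "d\<^sub>1 + d\<^sub>2 = 2"
      using sizes by simp
    have "complex_of_nat (card (evens A) + card (odds B)) = complex_of_nat (card (odds A) + card (evens B))"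
      using H by (simp only:)
    then have "\<epsilon> * (d\<^sub>2 - d\<^sub>1) = 0"
      unfolding parities[symmetric] by (simp add: algebra_simps)
    then have "d\<^sub>2 = d\<^sub>1"
      using eps_cases by auto
    with sum2 have d: "d\<^sub>1 = 1" "d\<^sub>2 = 1"
      by simp_all
    have s: "(1 :: complex) = 1 \<or> (1 :: complex) = - 1"
      by simp
    have disj: "D1 \<omega> \<inter> ?M = {}"
      by (auto simp: D1_eq mixed_set_def)
    have ps: "pair_sum (D1 \<omega> \<union> ?M) a b
        = pair_sum ?M a b + (\<Sum>y\<in>{y. \<chi> y = 1}. canonical_char p (2 * m) \<zeta> (a * y))" for a b
      unfolding pair_sum_Un[OF disj] unfolding D1_eq pair_sum_axis by (rule add.commute)
    have "type_Q p m \<zeta> (D1 \<omega> \<union> ?M)"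
    proof (rule type_Q)
      show "(0, 0) \<notin> D1 \<omega> \<union> ?M"
        by (auto simp: D1_eq mixed_set_def)
      show "(t * x, t * y) \<in> D1 \<omega> \<union> ?M" if "t \<in> F - {0}" "(x, y) \<in> D1 \<omega> \<union> ?M" for t x y
        using that mixed_set_scale by (auto simp: D1_eq quad_char_mult quad_char_F)
      show "pair_sum (D1 \<omega> \<union> ?M) 0 0 = (of_nat q ^ 4 - 1) / 4"
        unfolding ps pair_sum_mixed_0_0 sum_psi_class[OF s]
        by (simp add: field_simps power2_eq_square power4_eq_xxxx)
      show "pair_sum (D1 \<omega> \<union> ?M) a b \<in> two_values" if "(a, b) \<noteq> (0, 0)" for a b
        unfolding ps using that d by (rule char_values_D1)
    qed
    then show "type_Q p m \<zeta> (D1 \<omega> \<union> D2 q \<omega> A \<union> D3 q \<omega> B)"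
      by (simp only: Un_assoc D2_Un_D3_eq[OF assms(10,11)])
  qed
qed

end
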